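(* Let $G$ be a topological group that is not locally compact, let $bG$ be a Hausdorff compactification of $G$, and suppose that $Y = bG \setminus G$ has a BCO (base of countable order). If $G$ is a $\Sigma$-space, then $G$ and $bG$ are separable and metrizable.
   Context: All spaces (including topological groups) are assumed Hausdorff. A Hausdorff compactification $bG$ of $G$ is a compact Hausdorff space containing $G$ as a dense subspace. A space $X$ has a base of countable order (BCO) if there is a sequence $\{\mathcal{B}_n\}_{n\in\mathbb{N}}$ of bases for $X$ such that whenever $x \in b_n \in \mathcal{B}_n$ for all $n$ and $(b_n)$ is decreasing (by set inclusion), then $\{b_n : n \in \mathbb{N}\}$ is a base at $x$. A space $X$ is a $\Sigma$-space (in the sense of Nagami) if there are a $\sigma$-locally finite collection $\mathcal{F}$ of closed subsets of $X$ and a cover $\mathcal{C}$ of $X$ by closed countably compact subsets such that whenever $C \in \mathcal{C}$ and $C \subset U$ with $U$ open in $X$, there is $F \in \mathcal{F}$ with $C \subset F \subset U$. *)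

theory Defs
  imports "HOL-Analysis.Analysis" "HOL-Algebra.Group"
begin

text \<open>All spaces are assumed Hausdorff; this includes topological groups.\<close>

locale topological_group = group G for G :: "('a, 'b) monoid_scheme" (structure) +
  fixes T :: "'a topology"
  assumes topspace_eq_carrier: "topspace T = carrier G"
    and Hausdorff: "Hausdorff_space T"
    and continuous_mult:
      "continuous_map (prod_topology T T) T (\<lambda>(x, y). x \<otimes> y)"
    and continuous_inv: "continuous_map T T (\<lambda>x. inv x)"

text \<open>The space \<open>X\<close> is literally a dense subspace of its compactification \<open>K\<close>,
  so the remainder is \<open>topspace K - topspace X\<close> with the subspace topology.\<close>

definition Hausdorff_compactification :: "'a topology \<Rightarrow> 'a topology \<Rightarrow> bool" where
  "Hausdorff_compactification X K \<longleftrightarrow>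
     compact_space K \<and> Hausdorff_space K \<and>
     topspace X \<subseteq> topspace K \<and> subtopology K (topspace X) = X \<and>
     K closure_of topspace X = topspace K"

definition base_of_topology :: "'a topology \<Rightarrow> 'a set set \<Rightarrow> bool" where
  "base_of_topology X \<B> \<longleftrightarrow>
     (\<forall>b\<in>\<B>. openin X b) \<and>
     (\<forall>U x. openin X U \<and> x \<in> U \<longrightarrow> (\<exists>b\<in>\<B>. x \<in> b \<and> b \<subseteq> U))"

definition base_at :: "'a topology \<Rightarrow> 'a \<Rightarrow> 'a set set \<Rightarrow> bool" where
  "base_at X x \<B> \<longleftrightarrow>
     (\<forall>b\<in>\<B>. openin X b \<and> x \<in> b) \<and>
     (\<forall>U. openin X U \<and> x \<in> U \<longrightarrow> (\<exists>b\<in>\<B>. b \<subseteq> U))"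

definition has_BCO :: "'a topology \<Rightarrow> bool" where
  "has_BCO X \<longleftrightarrow>
     (\<exists>\<B> :: nat \<Rightarrow> 'a set set.
        (\<forall>n. base_of_topology X (\<B> n)) \<and>
        (\<forall>x b. (\<forall>n. x \<in> b n \<and> b n \<in> \<B> n) \<and> decseq b \<longrightarrow> base_at X x (range b)))"

definition countably_compactin :: "'a topology \<Rightarrow> 'a set \<Rightarrow> bool" where
  "countably_compactin X C \<longleftrightarrow>
     C \<subseteq> topspace X \<and>
     (\<forall>\<U>. countable \<U> \<and> (\<forall>U\<in>\<U>. openin X U) \<and> C \<subseteq> \<Union>\<U> \<longrightarrow>
        (\<exists>\<V>. finite \<V> \<and> \<V> \<subseteq> \<U> \<and> C \<subseteq> \<Union>\<V>))"

definition sigma_locally_finite_in :: "'a topology \<Rightarrow> 'a set set \<Rightarrow> bool" where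
  "sigma_locally_finite_in X \<F> \<longleftrightarrow>
     (\<exists>\<G> :: nat \<Rightarrow> 'a set set. (\<forall>n. locally_finite_in X (\<G> n)) \<and> \<F> = (\<Union>n. \<G> n))"

text \<open>\<open>\<Sigma>\<close>-spaces in the sense of Nagami\<close>

definition Sigma_space :: "'a topology \<Rightarrow> bool" where
  "Sigma_space X \<longleftrightarrow>
     (\<exists>\<F> \<C>.
        sigma_locally_finite_in X \<F> \<and> (\<forall>F\<in>\<F>. closedin X F) \<and>
        (\<forall>C\<in>\<C>. closedin X C \<and> countably_compactin X C) \<and> \<Union>\<C> = topspace X \<and>
        (\<forall>C\<in>\<C>. \<forall>U. openin X U \<and> C \<subseteq> U \<longrightarrow> (\<exists>F\<in>\<F>. C \<subseteq> F \<and> F \<subseteq> U)))"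

end

theory Submission
  imports Defs
begin

text \<open>
  Write \<open>K\<close> for the compactification \<open>bG\<close> and \<open>Y\<close> for the remainder. A nonempty open subset of a
  group that is not locally compact has no compact closure, so \<open>Y\<close> is dense in \<open>K\<close>, and every point
  of \<open>Y\<close> has a countable base in \<open>K\<close>, because \<open>Y\<close> has a base of countable order. Everything depends on
  whether the closure of a countable subset of \<open>Y\<close> can reach \<open>G\<close>.

  Suppose that it can, at the point \<open>p\<close>. The countable bases at the points of the countable set form a
  countable \<open>\<pi>\<close>-base at \<open>p\<close>, and if the open sets \<open>P\<close> form a \<open>\<pi>\<close>-base at \<open>p\<close>, then the sets
  \<open>P P\<^sup>-\<^sup>1\<close> form a base at \<open>\<one>\<close>. So \<open>G\<close> is first countable. Then every compact subset of \<open>G\<close> is a countable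
  intersection of open subsets of \<open>K\<close>, which makes \<open>Y\<close> a Lindelof
  space. A regular Lindelof space with a base of countable order has a countable base. This base
  extends to \<open>K\<close> and makes \<open>G\<close> separable; a separable first countable group is second countable, and
  the extended bases of the two dense pieces \<open>Y\<close> and \<open>G\<close> together form a countable base of \<open>K\<close>.

  Suppose that it cannot. This contradicts the \<open>\<Sigma>\<close>-property, in three steps.

  \<^item> \<open>G\<close> is \<open>\<sigma>\<close>-compact near \<open>\<one>\<close>. The countably compact sets of the cover are closed in \<open>K\<close>, as points of \<open>Y\<close>
    have countable bases. For each of the locally finite families, the points of \<open>K\<close> at which it
    stops being locally finite form a compact subset of \<open>Y\<close>, which is separable by the base of countable
    order; so \<open>\<one>\<close> has a closed neighbourhood that avoids all these points, and only
    countably many members of the network meet it. Picking one point of \<open>Y\<close> in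
    each finite intersection of closures of such members, when there is one, gives a countable set whose closure stays in \<open>Y\<close>; therefore every point of \<open>G\<close> nearby
    lies in a finite intersection that misses \<open>Y\<close>, a compact subset of \<open>G\<close>.

  \<^item> Disjoint families of open sets near \<open>\<one>\<close> are then countable. This is the chain condition of
    \<open>\<sigma>\<close>-compact groups (Tkachenko, Uspenskij): given \<open>x\<^sub>U \<in> U\<close> in a compact set for each member \<open>U\<close>, a
    closing-off argument finds members \<open>U \<noteq> V\<close> and a point \<open>y\<close> such that \<open>x\<^sub>U y\<^sup>-\<^sup>1 x\<^sub>V\<close> lies in both.

  \<^item> Consequently the maximal disjoint families of open sets that refine each other and have traces in
    the \<open>n\<close>-th base of \<open>Y\<close> are countable. Decreasing sequences of their members
    shrink to points of \<open>Y\<close>, so these members form a countable \<open>\<pi>\<close>-base near \<open>\<one>\<close>. Choosing a point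
    of \<open>Y\<close> in each of them gives a countable subset of \<open>Y\<close> whose closure contains \<open>\<one>\<close>.
\<close>

text \<open>The closure of a congruence would make every topological closure an ambiguous term.\<close>

no_notation eq_closure_of ("closure'_of\<index>")

section \<open>Dense subspaces and compact Hausdorff spaces\<close>

lemma open_subset_closure_of_trace:
  assumes "K closure_of S = topspace K" "openin K V"
  shows "V \<subseteq> K closure_of (V \<inter> S)"
  using openin_Int_closure_of_subset[OF assms(2), of S] openin_subset[OF assms(2)] assms(1) by auto

lemma regular_space_shrink:
  assumes "regular_space X" "openin X U" "x \<in> U"
  obtains V where "openin X V" "x \<in> V" "X closure_of V \<subseteq> U"
proof -
  have "neighbourhood_base_of (closedin X) X"
    using assms(1) neighbourhood_base_of_closedin by blast
  then obtain V C where "openin X V" "closedin X C" "x \<in> V" "V \<subseteq> C" "C \<subseteq> U"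
    using assms(2,3) unfolding neighbourhood_base_of by meson
  then show ?thesis
    using that closure_of_minimal by (metis order_trans)
qed

text \<open>
  A set open in \<open>K\<close> lies in the closure of its trace on a dense subspace, so by regularity small traces
  come from small sets, whichever open extensions are chosen.
\<close>
lemma base_at_dense_extension:
  assumes "regular_space K" and dense: "K closure_of S = topspace K"
    and base: "base_at (subtopology K S) y (range b)"
    and V: "\<And>n. openin K (V n)" "\<And>n. V n \<inter> S = b n"
  shows "base_at K y (range V)"
  unfolding base_at_def
proof (intro conjI ballI allI impI)
  fix W assume "W \<in> range V"
  then show "openin K W" "y \<in> W"
    using V base by (auto simp: base_at_def)
next
  fix U assume U: "openin K U \<and> y \<in> U"
  then obtain U' where U': "openin K U'" "y \<in> U'" "K closure_of U' \<subseteq> U"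
    using regular_space_shrink[OF assms(1)] by metis
  have "y \<in> S"
    using base V(2) by (auto simp: base_at_def)
  then have "openin (subtopology K S) (U' \<inter> S)" "y \<in> U' \<inter> S"
    using U' by (auto simp: openin_subtopology)
  then obtain n where "b n \<subseteq> U' \<inter> S"
    using base unfolding base_at_def by (metis rangeE)
  have "V n \<subseteq> K closure_of (V n \<inter> S)"
    using open_subset_closure_of_trace[OF dense V(1)] .
  also have "\<dots> \<subseteq> K closure_of U'"
    using \<open>b n \<subseteq> U' \<inter> S\<close> V(2)[of n] by (intro closure_of_mono) simp
  finally have "V n \<subseteq> K closure_of U'" .
  then show "\<exists>W\<in>range V. W \<subseteq> U"
    using U'(3) by blast
qed

lemma dense_extension_of_countable_base:
  assumes reg: "regular_space K" and dense: "K closure_of S = topspace K"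
    and sc: "second_countable (subtopology K S)"
  shows "\<exists>\<B>. countable \<B> \<and> (\<forall>V\<in>\<B>. openin K V) \<and>
    (\<forall>U x. openin K U \<and> x \<in> U \<and> x \<in> S \<longrightarrow> (\<exists>V\<in>\<B>. x \<in> V \<and> V \<subseteq> U))"
proof -
  obtain \<C> where \<C>: "countable \<C>" "\<And>b. b \<in> \<C> \<Longrightarrow> openin (subtopology K S) b"
    "\<And>U x. openin (subtopology K S) U \<Longrightarrow> x \<in> U \<Longrightarrow> \<exists>b\<in>\<C>. x \<in> b \<and> b \<subseteq> U"
    using sc unfolding second_countable_def by metis
  have "\<forall>b\<in>\<C>. \<exists>V. openin K V \<and> b = V \<inter> S"
    using \<C>(2) by (simp add: openin_subtopology)
  from bchoice[OF this] obtain V where V: "\<forall>b\<in>\<C>. openin K (V b) \<and> b = V b \<inter> S"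
    by (rule exE)
  have base: "\<exists>W\<in>V ` \<C>. x \<in> W \<and> W \<subseteq> U" if U: "openin K U" "x \<in> U" "x \<in> S" for U x
  proof -
    obtain N where N: "openin K N" "x \<in> N" "K closure_of N \<subseteq> U"
      using regular_space_shrink[OF reg U(1,2)] .
    have "openin (subtopology K S) (N \<inter> S)"
      using N(1) by (auto simp: openin_subtopology)
    then obtain b where b: "b \<in> \<C>" "x \<in> b" "b \<subseteq> N \<inter> S"
      using \<C>(3) N(2) U(3) by (metis IntI)
    have Vb: "openin K (V b)" "V b \<inter> S = b" using V b(1) by auto
    have "V b \<subseteq> K closure_of (V b \<inter> S)"
      using open_subset_closure_of_trace[OF dense Vb(1)] .
    also have "\<dots> \<subseteq> K closure_of N"
      using b(3) Vb(2) by (intro closure_of_mono) auto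
    finally have "V b \<subseteq> U" using N(3) by simp
    moreover have "x \<in> V b" using b(2) Vb(2) by auto
    ultimately show ?thesis using b(1) by blast
  qed
  show ?thesis
    using \<C>(1) V base by (intro exI[of _ "V ` \<C>"]) auto
qed

lemma compact_meets_finitely_many:
  assumes Q: "compactin K Q"
    and locally_finite: "\<And>z. z \<in> Q \<Longrightarrow> \<exists>V. openin K V \<and> z \<in> V \<and> finite {F\<in>\<F>. F \<inter> V \<noteq> {}}"
  shows "finite {F\<in>\<F>. F \<inter> Q \<noteq> {}}"
proof -
  define \<V> where "\<V> = {V. openin K V \<and> finite {F\<in>\<F>. F \<inter> V \<noteq> {}}}"
  have "Q \<subseteq> \<Union>\<V>" using locally_finite by (auto simp: \<V>_def)
  then have "\<exists>\<W>. finite \<W> \<and> \<W> \<subseteq> \<V> \<and> Q \<subseteq> \<Union>\<W>"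
    by (intro compactinD[OF Q]) (simp_all add: \<V>_def)
  then obtain \<W> where \<W>: "finite \<W>" "\<W> \<subseteq> \<V>" "Q \<subseteq> \<Union>\<W>" by (elim exE conjE)
  have "finite (\<Union>V\<in>\<W>. {F\<in>\<F>. F \<inter> V \<noteq> {}})"
    using \<W>(1,2) by (intro finite_UN_I) (auto simp: \<V>_def)
  moreover have "{F\<in>\<F>. F \<inter> Q \<noteq> {}} \<subseteq> (\<Union>V\<in>\<W>. {F\<in>\<F>. F \<inter> V \<noteq> {}})"
    using \<W>(3) by auto
  ultimately show ?thesis by (rule rev_finite_subset)
qed

text \<open>
  Countably many Urysohn functions, one for each pair of basic sets with disjoint closures, separate
  points and embed the space into the metrizable space of real sequences.
\<close>
lemma compact_Hausdorff_second_countable_imp_metrizable: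
  assumes comp: "compact_space K" and Haus: "Hausdorff_space K" and "second_countable K"
  shows "metrizable_space K"
proof -
  obtain \<B> where \<B>: "countable \<B>" "\<And>V. V \<in> \<B> \<Longrightarrow> openin K V"
    "\<And>U x. openin K U \<Longrightarrow> x \<in> U \<Longrightarrow> \<exists>V\<in>\<B>. x \<in> V \<and> V \<subseteq> U"
    using assms(3) unfolding second_countable_def by metis
  have normal: "normal_space K" and reg: "regular_space K"
    using comp Haus compact_Hausdorff_or_regular_imp_normal_space
      compact_Hausdorff_imp_regular_space by blast+
  define \<P> where "\<P> = {(A, B). A \<in> \<B> \<and> B \<in> \<B> \<and> disjnt (K closure_of A) (K closure_of B)}"
  have "countable \<P>"
    by (rule countable_subset[of _ "\<B> \<times> \<B>"]) (use \<B>(1) in \<open>auto simp: \<P>_def\<close>)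
  have "\<exists>f. continuous_map K euclideanreal f \<and> f ` (K closure_of fst p) \<subseteq> {0} \<and>
      f ` (K closure_of snd p) \<subseteq> {1}" if "p \<in> \<P>" for p
  proof -
    have "disjnt (K closure_of fst p) (K closure_of snd p)"
      using that by (auto simp: \<P>_def)
    from Urysohn_lemma_alt[OF normal closedin_closure_of closedin_closure_of this, of 0 1]
    show ?thesis by metis
  qed
  then obtain F where F: "\<And>p. p \<in> \<P> \<Longrightarrow> continuous_map K euclideanreal (F p)"
    "\<And>p. p \<in> \<P> \<Longrightarrow> F p ` (K closure_of fst p) \<subseteq> {0}"
    "\<And>p. p \<in> \<P> \<Longrightarrow> F p ` (K closure_of snd p) \<subseteq> {1}"
    by metis
  define g :: "_ \<Rightarrow> nat \<Rightarrow> real"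
    where "g x n = (if n \<in> to_nat_on \<P> ` \<P> then F (from_nat_into \<P> n) x else 0)" for x n
  have "continuous_map K euclideanreal (\<lambda>x. g x n)" for n
  proof (cases "n \<in> to_nat_on \<P> ` \<P>")
    case True
    then have "from_nat_into \<P> n \<in> \<P>"
      by (metis empty_iff from_nat_into image_is_empty)
    then show ?thesis using F(1) True by (simp add: g_def)
  next
    case False
    then show ?thesis by (simp add: g_def)
  qed
  then have cont: "continuous_map K (euclidean :: (nat \<Rightarrow> real) topology) g"
    using continuous_map_componentwise_UNIV[of K "\<lambda>_. euclideanreal" g]
    by (simp add: euclidean_product_topology)
  have "inj_on g (topspace K)"
  proof (rule inj_onI, rule ccontr)
    fix x y assume xy: "x \<in> topspace K" "y \<in> topspace K" "g x = g y" "x \<noteq> y"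
    then obtain U V where UV: "openin K U" "openin K V" "x \<in> U" "y \<in> V" "disjnt U V"
      using Haus unfolding Hausdorff_space_def by metis
    obtain U' where U': "openin K U'" "x \<in> U'" "K closure_of U' \<subseteq> U"
      using regular_space_shrink[OF reg UV(1,3)] .
    obtain V' where V': "openin K V'" "y \<in> V'" "K closure_of V' \<subseteq> V"
      using regular_space_shrink[OF reg UV(2,4)] .
    obtain A where A: "A \<in> \<B>" "x \<in> A" "A \<subseteq> U'" using \<B>(3) U' by metis
    obtain B where B: "B \<in> \<B>" "y \<in> B" "B \<subseteq> V'" using \<B>(3) V' by metis
    have "K closure_of A \<subseteq> U" "K closure_of B \<subseteq> V"
      using A B U' V' closure_of_mono by (metis order_trans)+
    then have p: "(A, B) \<in> \<P>"
      using A B UV(5) by (auto simp: \<P>_def disjnt_def)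
    have "x \<in> K closure_of A" "y \<in> K closure_of B"
      using A B xy by (auto simp: in_closure_of)
    then have "F (A, B) x = 0" "F (A, B) y = 1"
      using F(2,3)[OF p] by auto
    moreover have "F (A, B) x = F (A, B) y"
      using fun_cong[OF xy(3), of "to_nat_on \<P> (A, B)"] p \<open>countable \<P>\<close> by (simp add: g_def)
    ultimately show False by simp
  qed
  then have "embedding_map K (euclidean :: (nat \<Rightarrow> real) topology) g"
    by (intro continuous_imp_embedding_map cont comp) auto
  then have "K homeomorphic_space subtopology euclidean (g ` topspace K)"
    by (rule embedding_map_imp_homeomorphic_space)
  then show ?thesis
    by (meson homeomorphic_metrizable_space metrizable_space_euclidean metrizable_space_subtopology)
qed

text \<open>
  By Zorn's lemma; a member that meets nothing in a maximal disjoint subfamily could be added to it.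
\<close>
lemma maximal_disjoint_subfamily:
  obtains \<W> where "\<W> \<subseteq> \<V>" "pairwise disjnt \<W>"
    "\<And>V. V \<in> \<V> \<Longrightarrow> V \<noteq> {} \<Longrightarrow> \<exists>W\<in>\<W>. W \<inter> V \<noteq> {}"
proof -
  have "\<exists>M\<in>{\<W>. \<W> \<subseteq> \<V> \<and> pairwise disjnt \<W>}. \<forall>X\<in>{\<W>. \<W> \<subseteq> \<V> \<and> pairwise disjnt \<W>}.
      M \<subseteq> X \<longrightarrow> X = M"
  proof (rule subset_Zorn')
    fix \<C> assume "subset.chain {\<W>. \<W> \<subseteq> \<V> \<and> pairwise disjnt \<W>} \<C>"
    then have \<C>: "\<And>\<W>. \<W> \<in> \<C> \<Longrightarrow> \<W> \<subseteq> \<V> \<and> pairwise disjnt \<W>"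
      and chain: "\<And>\<W> \<W>'. \<W> \<in> \<C> \<Longrightarrow> \<W>' \<in> \<C> \<Longrightarrow> \<W> \<subseteq> \<W>' \<or> \<W>' \<subseteq> \<W>"
      by (auto simp: subset_chain_def)
    then have "pairwise disjnt (\<Union>\<C>)"
      by (intro pairwise_chain_Union) (auto simp: chain_subset_def)
    with \<C> show "\<Union>\<C> \<in> {\<W>. \<W> \<subseteq> \<V> \<and> pairwise disjnt \<W>}"
      by blast
  qed
  then obtain \<W> where \<W>_mem: "\<W> \<in> {\<W>. \<W> \<subseteq> \<V> \<and> pairwise disjnt \<W>}"
    and \<W>_max: "\<forall>\<X>\<in>{\<W>. \<W> \<subseteq> \<V> \<and> pairwise disjnt \<W>}. \<W> \<subseteq> \<X> \<longrightarrow> \<X> = \<W>"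
    by (rule bexE)
  then have \<W>: "\<W> \<subseteq> \<V>" "pairwise disjnt \<W>" by simp_all
  show ?thesis
  proof (rule that[OF \<W>(1,2)], rule ccontr)
    fix V assume V: "V \<in> \<V>" "V \<noteq> {}" "\<not> (\<exists>W\<in>\<W>. W \<inter> V \<noteq> {})"
    then have "pairwise disjnt (insert V \<W>)"
      using \<W>(2) by (auto simp: pairwise_insert disjnt_def)
    then have "V \<in> \<W>" using \<W>(1) bspec[OF \<W>_max, of "insert V \<W>"] V(1) by auto
    then show False using V by blast
  qed
qed

section \<open>Bases of countable order\<close>

lemma has_BCO_decreasing_base_at:
  assumes "has_BCO X" "x \<in> topspace X"
  obtains b :: "nat \<Rightarrow> 'a set" where "decseq b" "base_at X x (range b)"
proof -
  obtain \<B> :: "nat \<Rightarrow> 'a set set" where base: "\<And>n. base_of_topology X (\<B> n)"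
    and BCO: "\<And>x b. \<forall>n. x \<in> b n \<and> b n \<in> \<B> n \<Longrightarrow> decseq b \<Longrightarrow> base_at X x (range b)"
    using assms(1) unfolding has_BCO_def by metis
  have "\<exists>b. \<forall>n. (x \<in> b n \<and> b n \<in> \<B> n) \<and> b (Suc n) \<subseteq> b n"
  proof (rule dependent_nat_choice)
    show "\<exists>c. x \<in> c \<and> c \<in> \<B> 0"
      using base[of 0] assms(2) unfolding base_of_topology_def by (metis openin_topspace)
    show "\<exists>c'. (x \<in> c' \<and> c' \<in> \<B> (Suc n)) \<and> c' \<subseteq> c" if "x \<in> c \<and> c \<in> \<B> n" for c n
      using that base[of n] base[of "Suc n"] unfolding base_of_topology_def by metis
  qed
  then obtain b where "\<And>n. x \<in> b n \<and> b n \<in> \<B> n" "\<And>n. b (Suc n) \<subseteq> b n" by blast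
  then show ?thesis
    using that BCO decseq_SucI by metis
qed

text \<open>
  Cover the space by members of the first base, cover each part of that cover by members of the second
  base inside it, and so on, with countable covers throughout. A point of the Lindelof set runs through
  a decreasing sequence of members, which is a base at the point, so the countably many sets that occur are
  enough. Being Lindelof passes to closed subsets but not to open ones. The construction
  therefore carries pairs \<open>(v, b)\<close> with the closure of \<open>v\<close> inside the basic set \<open>b\<close>: the next cover has to
  cover only the closure of \<open>v\<close>, while its members stay inside \<open>b\<close>.
\<close>
lemma BCO_Lindelof_countable_base:
  fixes X :: "'a topology"
  assumes reg: "regular_space X" and "has_BCO X" and R: "R \<subseteq> topspace X"
    and Lindelof: "Lindelof_space (subtopology X R)"
  obtains \<C> where "countable \<C>" "\<And>b. b \<in> \<C> \<Longrightarrow> openin X b"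
    "\<And>x U. x \<in> R \<Longrightarrow> openin X U \<Longrightarrow> x \<in> U \<Longrightarrow> \<exists>b\<in>\<C>. x \<in> b \<and> b \<subseteq> U"
proof -
  obtain \<B> :: "nat \<Rightarrow> 'a set set" where base: "\<And>n. base_of_topology X (\<B> n)"
    and BCO: "\<And>x b. \<forall>n. x \<in> b n \<and> b n \<in> \<B> n \<Longrightarrow> decseq b \<Longrightarrow> base_at X x (range b)"
    using assms(2) unfolding has_BCO_def by metis
  have openB: "openin X b" if "b \<in> \<B> n" for b n
    using base that by (auto simp: base_of_topology_def)
  have baseE: "\<exists>b\<in>\<B> n. x \<in> b \<and> b \<subseteq> U" if "openin X U" "x \<in> U" for x U n
    using base[of n] that by (auto simp: base_of_topology_def)
  define Q where "Q n p P \<longleftrightarrow> countable P \<and> R \<inter> X closure_of (fst p) \<subseteq> (\<Union>p'\<in>P. fst p') \<and>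
      (\<forall>p'\<in>P. snd p' \<in> \<B> n \<and> snd p' \<subseteq> snd p \<and> X closure_of (fst p') \<subseteq> snd p')"
    for n and p :: "'a set \<times> 'a set" and P
  have step: "\<exists>P. Q n p P" if b: "openin X (snd p)" "X closure_of (fst p) \<subseteq> snd p" for n p
  proof -
    define \<U> where "\<U> = {v'. openin X v' \<and> (\<exists>b'\<in>\<B> n. b' \<subseteq> snd p \<and> X closure_of v' \<subseteq> b')}"
    have "x \<in> \<Union>\<U>" if xv: "x \<in> X closure_of fst p" for x
    proof -
      obtain b' where b': "b' \<in> \<B> n" "x \<in> b'" "b' \<subseteq> snd p"
        using baseE[OF b(1) subsetD[OF b(2) xv], of n] by blast
      obtain v' where "openin X v'" "x \<in> v'" "X closure_of v' \<subseteq> b'"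
        using regular_space_shrink[OF reg openB[OF b'(1)] b'(2)] .
      then show ?thesis
        using b' by (auto simp: \<U>_def)
    qed
    \<comment> \<open>Adding the complement of the closed set turns this into a cover of all of \<open>R\<close>.\<close>
    then have "R \<subseteq> \<Union>(insert (topspace X - X closure_of fst p) \<U>)" using R by blast
    moreover have "\<forall>U\<in>insert (topspace X - X closure_of fst p) \<U>. openin X U"
      by (auto simp: \<U>_def)
    ultimately obtain \<V> where \<V>: "countable \<V>" "\<V> \<subseteq> insert (topspace X - X closure_of fst p) \<U>"
      "R \<subseteq> \<Union>\<V>"
      using Lindelof unfolding Lindelof_space_subtopology_subset[OF R] by meson
    define B where "B v' = (SOME b'. b' \<in> \<B> n \<and> b' \<subseteq> snd p \<and> X closure_of v' \<subseteq> b')" for v'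
    have B: "B v' \<in> \<B> n \<and> B v' \<subseteq> snd p \<and> X closure_of v' \<subseteq> B v'" if "v' \<in> \<U>" for v'
      unfolding B_def by (rule someI_ex) (use that in \<open>auto simp: \<U>_def\<close>)
    define P where "P = (\<lambda>v'. (v', B v')) ` (\<V> \<inter> \<U>)"
    have "countable P" using \<V>(1) by (simp add: P_def)
    moreover have "R \<inter> X closure_of fst p \<subseteq> \<Union>(\<V> \<inter> \<U>)" using \<V>(2,3) by blast
    then have "R \<inter> X closure_of fst p \<subseteq> (\<Union>p'\<in>P. fst p')" by (simp add: P_def)
    moreover have "snd p' \<in> \<B> n \<and> snd p' \<subseteq> snd p \<and> X closure_of (fst p') \<subseteq> snd p'" if p': "p' \<in> P" for p'
    proof -
      obtain v' where "p' = (v', B v')" "v' \<in> \<U>" using p' by (auto simp: P_def)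
      then show ?thesis using B[of v'] by simp
    qed
    ultimately show ?thesis unfolding Q_def by blast
  qed
  define N where "N n p = (SOME P. Q n p P)" for n p
  have "Q n p (N n p)" if "openin X (snd p)" "X closure_of (fst p) \<subseteq> snd p" for n p
    unfolding N_def using step[OF that] by (rule someI_ex)
  then have N: "countable (N n p)" "R \<inter> X closure_of (fst p) \<subseteq> (\<Union>p'\<in>N n p. fst p')"
      "\<And>p'. p' \<in> N n p \<Longrightarrow> snd p' \<in> \<B> n \<and> snd p' \<subseteq> snd p \<and> X closure_of (fst p') \<subseteq> snd p'"
    if "openin X (snd p)" "X closure_of (fst p) \<subseteq> snd p" for n p
    using that unfolding Q_def by blast+
  define L where "L = rec_nat {(topspace X, topspace X)} (\<lambda>n A. \<Union>p\<in>A. N n p)"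
  have L0: "L 0 = {(topspace X, topspace X)}" and LS: "L (Suc n) = (\<Union>p\<in>L n. N n p)" for n
    by (simp_all add: L_def)
  have inv: "countable (L n) \<and> (\<forall>p\<in>L n. openin X (snd p) \<and> X closure_of (fst p) \<subseteq> snd p)" for n
  proof (induction n)
    case 0
    then show ?case by (simp add: L0)
  next
    case (Suc n)
    then have p: "openin X (snd p)" "X closure_of (fst p) \<subseteq> snd p" if "p \<in> L n" for p
      using that by auto
    have "countable (L (Suc n))"
      unfolding LS using Suc p by (intro countable_UN N(1)) auto
    moreover have "openin X (snd p') \<and> X closure_of (fst p') \<subseteq> snd p'" if "p' \<in> L (Suc n)" for p'
    proof -
      from that have "\<exists>p\<in>L n. p' \<in> N n p" by (simp add: LS)
      then obtain q where "q \<in> L n" "p' \<in> N n q" by (rule bexE)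
      then show ?thesis using N(3)[OF p] openB by metis
    qed
    ultimately show ?case by blast
  qed
  show ?thesis
  proof (rule that)
    show "countable (\<Union>n. snd ` L n)" using inv by blast
    show "openin X b" if "b \<in> (\<Union>n. snd ` L n)" for b using inv that by blast
  next
    fix x U assume x: "x \<in> R" and U: "openin X U" "x \<in> U"
    have "\<exists>p. \<forall>n. (p n \<in> L n \<and> x \<in> X closure_of (fst (p n))) \<and>
        (p (Suc n) \<in> N n (p n) \<and> x \<in> fst (p (Suc n)))"
    proof (rule dependent_nat_choice)
      show "\<exists>p. p \<in> L 0 \<and> x \<in> X closure_of (fst p)"
        using x R by (auto simp: L0)
      fix p n assume p: "p \<in> L n \<and> x \<in> X closure_of fst p"
      then obtain p' where p': "p' \<in> N n p" "x \<in> fst p'"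
        using subsetD[OF N(2)[of p n], of x] inv[of n] x by auto
      moreover have "p' \<in> L (Suc n)" using p p' by (auto simp: LS)
      moreover have "x \<in> X closure_of (fst p')"
        using x R p'(2) by (auto simp: in_closure_of)
      ultimately show "\<exists>p'. (p' \<in> L (Suc n) \<and> x \<in> X closure_of fst p') \<and>
          p' \<in> N n p \<and> x \<in> fst p'"
        by blast
    qed
    then obtain p where p: "\<And>n. p n \<in> L n" "\<And>n. x \<in> X closure_of (fst (p n))"
      "\<And>n. p (Suc n) \<in> N n (p n)" by blast
    have pS: "snd (p (Suc n)) \<in> \<B> n" "snd (p (Suc n)) \<subseteq> snd (p n)" for n
      using N(3)[OF _ _ p(3)[of n]] inv[of n] p(1)[of n] by blast+
    \<comment> \<open>The index is shifted because the root of the tree is the whole space, not a basic set.\<close>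
    have "base_at X x (range (\<lambda>n. snd (p (Suc n))))"
    proof (rule BCO)
      show "\<forall>n. x \<in> snd (p (Suc n)) \<and> snd (p (Suc n)) \<in> \<B> n"
        using pS inv p by blast
      show "decseq (\<lambda>n. snd (p (Suc n)))"
        using pS by (intro decseq_SucI)
    qed
    then have "\<exists>b\<in>range (\<lambda>n. snd (p (Suc n))). b \<subseteq> U"
      using U unfolding base_at_def by simp
    then obtain n where n: "snd (p (Suc n)) \<subseteq> U" by auto
    have "x \<in> snd (p (Suc n))" using inv[of "Suc n"] p(1,2)[of "Suc n"] by auto
    then show "\<exists>b\<in>\<Union>n. snd ` L n. x \<in> b \<and> b \<subseteq> U"
      using n p(1)[of "Suc n"] by blast
  qed
qed

section \<open>Countable reflection in compact sets\<close>

text \<open>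
  Iterate \<open>\<Phi>\<close> over all finite subsets, countably often.
\<close>
lemma countable_closing_off:
  assumes "\<And>s. finite s \<Longrightarrow> s \<subseteq> I \<Longrightarrow> countable (\<Phi> s) \<and> \<Phi> s \<subseteq> I"
  shows "\<exists>A. A \<subseteq> I \<and> countable A \<and> (\<forall>s. finite s \<and> s \<subseteq> A \<longrightarrow> \<Phi> s \<subseteq> A)"
proof -
  define A where "A = rec_nat {} (\<lambda>_ B. B \<union> (\<Union>s\<in>{s. finite s \<and> s \<subseteq> B}. \<Phi> s))"
  have A: "A 0 = {}" "A (Suc n) = A n \<union> (\<Union>s\<in>{s. finite s \<and> s \<subseteq> A n}. \<Phi> s)" for n
    by (simp_all add: A_def)
  have inv: "countable (A n) \<and> A n \<subseteq> I" for n
  proof (induction n)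
    case (Suc n)
    then have "countable {s. finite s \<and> s \<subseteq> A n}"
      using countable_Collect_finite_subset by blast
    moreover have "countable (\<Phi> s) \<and> \<Phi> s \<subseteq> I" if "finite s \<and> s \<subseteq> A n" for s
      using assms[of s] that Suc by blast
    ultimately have "countable (\<Union>s\<in>{s. finite s \<and> s \<subseteq> A n}. \<Phi> s) \<and>
        (\<Union>s\<in>{s. finite s \<and> s \<subseteq> A n}. \<Phi> s) \<subseteq> I"
      by (intro conjI countable_UN UN_least) auto
    then show ?case
      using Suc by (simp add: A)
  qed (simp add: A)
  have "mono A" by (rule monoI, rule lift_Suc_mono_le) (auto simp: A)
  show ?thesis
  proof (intro exI[of _ "\<Union>n. A n"] conjI allI impI)
    fix s assume s: "finite s \<and> s \<subseteq> (\<Union>n. A n)"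
    have "\<exists>n. s \<subseteq> A n" if "finite s" "s \<subseteq> (\<Union>n. A n)" for s
      using that
    proof (induction s)
      case (insert x s)
      then obtain n m where "s \<subseteq> A n" "x \<in> A m" by auto
      moreover have "A n \<subseteq> A (max n m)" "A m \<subseteq> A (max n m)"
        using monoD[OF \<open>mono A\<close>] by simp_all
      ultimately show ?case by blast
    qed auto
    then obtain n where "s \<subseteq> A n" using s by blast
    then have "\<Phi> s \<subseteq> A (Suc n)" using s by (auto simp: A)
    then show "\<Phi> s \<subseteq> (\<Union>n. A n)" by blast
  qed (use inv in auto)
qed

text \<open>
  Countably many indices are enough for every point \<open>x j\<close> to be imitated, as far as the covers of
  these same indices can tell, by a limit \<open>y\<close> of the points with these indices. The index set \<open>A\<close> is closed
  under picking, for finitely many of its indices and a choice of one cell for each, an index whose point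
  lies in all these cells. Compactness then gives a limit point that shares a cell with \<open>x j\<close> in
  all the covers with indices in \<open>A\<close>.
\<close>
lemma countable_reflection_of_finite_closed_covers:
  fixes x :: "'i \<Rightarrow> 'a" and E :: "'i \<Rightarrow> 'a set set"
  assumes Z: "compactin X Z" "closedin X Z" and x: "\<And>i. i \<in> I \<Longrightarrow> x i \<in> Z"
    and E: "\<And>i. i \<in> I \<Longrightarrow> finite (E i)" "\<And>i c. i \<in> I \<Longrightarrow> c \<in> E i \<Longrightarrow> closedin X c"
      "\<And>i. i \<in> I \<Longrightarrow> Z \<subseteq> \<Union>(E i)"
  shows "\<exists>A\<subseteq>I. countable A \<and>
    (\<forall>j\<in>I. \<exists>y\<in>X closure_of (x ` A) \<inter> Z. \<forall>i\<in>A. \<exists>c\<in>E i. y \<in> c \<and> x j \<in> c)"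
proof -
  define pick where "pick f s = (SOME j. j \<in> I \<and> (\<forall>i\<in>s. x j \<in> f i))" 
    for f :: "'i \<Rightarrow> 'a set" and s
  define \<Phi> where "\<Phi> s = I \<inter> (\<lambda>f. pick f s) ` (PiE s E)" for s
  have "countable (\<Phi> s) \<and> \<Phi> s \<subseteq> I" if "finite s" "s \<subseteq> I" for s
  proof -
    have "finite (PiE s E)" using that E(1) by (intro finite_PiE) auto
    then show ?thesis by (auto simp: \<Phi>_def countable_finite)
  qed
  then have "\<exists>A. A \<subseteq> I \<and> countable A \<and> (\<forall>s. finite s \<and> s \<subseteq> A \<longrightarrow> \<Phi> s \<subseteq> A)"
    by (rule countable_closing_off)
  then obtain A where A: "A \<subseteq> I" "countable A" "\<And>s. finite s \<Longrightarrow> s \<subseteq> A \<Longrightarrow> \<Phi> s \<subseteq> A"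
    by metis
  show ?thesis
  proof (intro exI[of _ A] conjI A(1,2) ballI)
    fix j assume j: "j \<in> I"
    have "\<forall>i\<in>A. \<exists>c. c \<in> E i \<and> x j \<in> c" using E(3) x j A(1) by blast
    then obtain c where c: "\<And>i. i \<in> A \<Longrightarrow> c i \<in> E i \<and> x j \<in> c i" by metis
    define \<C> where "\<C> = insert (X closure_of (x ` A)) (c ` A)"
    have "Z \<inter> \<Inter>\<F> \<noteq> {}" if \<F>: "finite \<F>" "\<F> \<subseteq> \<C>" for \<F>
    proof -
      have "finite (\<F> - {X closure_of (x ` A)})" "\<F> - {X closure_of (x ` A)} \<subseteq> c ` A"
        using \<F> by (auto simp: \<C>_def)
      then obtain s where s: "finite s" "s \<subseteq> A" "\<F> - {X closure_of (x ` A)} = c ` s"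
        by (meson finite_subset_image)
      define f where "f = restrict c s"
      have "f \<in> PiE s E" using c s(2) by (auto simp: f_def)
      have "\<exists>k. k \<in> I \<and> (\<forall>i\<in>s. x k \<in> f i)"
        using j c s(2) by (intro exI[of _ j]) (auto simp: f_def)
      then have k: "pick f s \<in> I" "\<And>i. i \<in> s \<Longrightarrow> x (pick f s) \<in> c i"
        using someI_ex[of "\<lambda>j. j \<in> I \<and> (\<forall>i\<in>s. x j \<in> f i)"] unfolding pick_def f_def by auto
      then have "pick f s \<in> A"
        using A(3)[OF s(1,2)] \<open>f \<in> PiE s E\<close> by (auto simp: \<Phi>_def)
      moreover have "x (pick f s) \<in> topspace X"
        using x[OF k(1)] compactin_subset_topspace[OF Z(1)] by blast
      ultimately have "x (pick f s) \<in> X closure_of (x ` A)"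
        by (auto simp: in_closure_of)
      then have "x (pick f s) \<in> Z \<inter> \<Inter>\<F>"
        using k s(3) x by blast
      then show ?thesis by blast
    qed
    moreover have "\<forall>C\<in>\<C>. closedin X C" using c E(2) A(1) by (auto simp: \<C>_def)
    ultimately have "Z \<inter> \<Inter>\<C> \<noteq> {}"
      using Z(1) unfolding compactin_fip by blast
    then obtain y where "y \<in> Z" "y \<in> X closure_of (x ` A)" "\<And>i. i \<in> A \<Longrightarrow> y \<in> c i"
      by (auto simp: \<C>_def)
    then show "\<exists>y\<in>X closure_of (x ` A) \<inter> Z. \<forall>i\<in>A. \<exists>c\<in>E i. y \<in> c \<and> x j \<in> c"
      using c by blast
  qed
qed

section \<open>Topological groups\<close>

lemma continuous_map_prod_neighbourhoods:
  assumes "continuous_map (prod_topology X Y) Z (\<lambda>(x, y). f x y)"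
    and "openin Z W" "x \<in> topspace X" "y \<in> topspace Y" "f x y \<in> W"
  obtains A B where "openin X A" "openin Y B" "x \<in> A" "y \<in> B"
    "\<And>a b. a \<in> A \<Longrightarrow> b \<in> B \<Longrightarrow> f a b \<in> W"
proof -
  define P where "P = {p \<in> topspace (prod_topology X Y). (\<lambda>(x, y). f x y) p \<in> W}"
  have "openin (prod_topology X Y) P"
    using assms(1,2) unfolding P_def by (rule openin_continuous_map_preimage)
  moreover have "(x, y) \<in> P" using assms(3-5) by (simp add: P_def)
  ultimately obtain A B where AB: "openin X A" "openin Y B" "x \<in> A" "y \<in> B" "A \<times> B \<subseteq> P"
    using openin_prod_topology_alt[of X Y P] by meson
  show ?thesis
  proof (rule that[OF AB(1-4)])
    fix a b assume "a \<in> A" "b \<in> B"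
    then have "(a, b) \<in> P" using AB(5) by blast
    then show "f a b \<in> W" by (simp add: P_def)
  qed
qed

context topological_group
begin

lemma open_subset_carrier: "openin T U \<Longrightarrow> U \<subseteq> carrier G"
  using openin_subset topspace_eq_carrier by fastforce

lemma one_topspace: "\<one> \<in> topspace T"
  by (simp add: topspace_eq_carrier)

lemma continuous_right_quotient:
  "continuous_map (prod_topology T T) T (\<lambda>(x, y). x \<otimes> inv y)"
proof -
  have "continuous_map (prod_topology T T) T (\<lambda>p. inv (snd p))"
    using continuous_map_compose[OF continuous_map_snd continuous_inv] by (simp add: comp_def)
  then have "continuous_map (prod_topology T T) (prod_topology T T) (\<lambda>p. (fst p, inv (snd p)))"
    by (simp add: continuous_map_paired continuous_map_fst)
  from continuous_map_compose[OF this continuous_mult] show ?thesis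
    by (simp add: comp_def case_prod_unfold)
qed

lemma continuous_left_quotient:
  "continuous_map (prod_topology T T) T (\<lambda>(x, y). inv x \<otimes> y)"
proof -
  have "continuous_map (prod_topology T T) T (\<lambda>p. inv (fst p))"
    using continuous_map_compose[OF continuous_map_fst continuous_inv] by (simp add: comp_def)
  then have "continuous_map (prod_topology T T) (prod_topology T T) (\<lambda>p. (inv (fst p), snd p))"
    by (simp add: continuous_map_paired continuous_map_snd)
  from continuous_map_compose[OF this continuous_mult] show ?thesis
    by (simp add: comp_def case_prod_unfold)
qed

lemma continuous_left_translation:
  assumes "a \<in> carrier G"
  shows "continuous_map T T (\<lambda>x. a \<otimes> x)"
proof -
  have "continuous_map T (prod_topology T T) (\<lambda>x. (a, x))"
    using assms by (simp add: continuous_map_paired topspace_eq_carrier)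
  from continuous_map_compose[OF this continuous_mult] show ?thesis
    by (simp add: comp_def)
qed

lemma continuous_right_translation:
  assumes "a \<in> carrier G"
  shows "continuous_map T T (\<lambda>x. x \<otimes> a)"
proof -
  have "continuous_map T (prod_topology T T) (\<lambda>x. (x, a))"
    using assms by (simp add: continuous_map_paired topspace_eq_carrier)
  from continuous_map_compose[OF this continuous_mult] show ?thesis
    by (simp add: comp_def)
qed

lemma open_left_preimage:
  assumes "a \<in> carrier G" "openin T U"
  shows "openin T {x \<in> carrier G. a \<otimes> x \<in> U}"
  using openin_continuous_map_preimage[OF continuous_left_translation[OF assms(1)] assms(2)]
  by (simp add: topspace_eq_carrier)

lemma open_right_preimage:
  assumes "a \<in> carrier G" "openin T U"
  shows "openin T {x \<in> carrier G. x \<otimes> a \<in> U}"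
  using openin_continuous_map_preimage[OF continuous_right_translation[OF assms(1)] assms(2)]
  by (simp add: topspace_eq_carrier)

text \<open>
  Translations would carry one compact neighbourhood to every point.
\<close>
lemma not_locally_compact_imp_nowhere_locally_compact:
  assumes "\<not> locally_compact_space T" "openin T U" "u \<in> U" "compactin T C"
  shows "\<not> U \<subseteq> C"
proof
  assume "U \<subseteq> C"
  have u: "u \<in> carrier G" using assms open_subset_carrier by blast
  have "\<exists>V D. openin T V \<and> compactin T D \<and> y \<in> V \<and> V \<subseteq> D" if "y \<in> topspace T" for y
  proof -
    define a where "a = u \<otimes> inv y"
    have y: "y \<in> carrier G" and a: "a \<in> carrier G"
      using that u by (auto simp: a_def topspace_eq_carrier)
    have ay: "a \<otimes> y = u" using u y by (simp add: a_def m_assoc)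
    have "x \<in> (\<lambda>z. inv a \<otimes> z) ` C" if "x \<in> carrier G" "a \<otimes> x \<in> U" for x
    proof
      show "x = inv a \<otimes> (a \<otimes> x)" using that a by (simp add: m_assoc[symmetric])
      show "a \<otimes> x \<in> C" using that \<open>U \<subseteq> C\<close> by blast
    qed
    moreover have "compactin T ((\<lambda>z. inv a \<otimes> z) ` C)"
      using image_compactin[OF assms(4) continuous_left_translation] a by simp
    ultimately show ?thesis
      using open_left_preimage[OF a assms(2)] ay y assms(3)
      by (intro exI[of _ "{x \<in> carrier G. a \<otimes> x \<in> U}"] exI[of _ "(\<lambda>z. inv a \<otimes> z) ` C"]) auto
  qed
  then show False using assms(1) unfolding locally_compact_space_def by blast
qed

text \<open>
  The chain condition of \<open>\<sigma>\<close>-compact groups, reduced to one compact set. Choose \<open>x V\<close> in each \<open>V \<inter> Z\<close>. For each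
  \<open>V\<close> cover \<open>Z\<close> by finitely many closed cells so small that \<open>x V \<otimes> (inv u \<otimes> v) \<in> V\<close> whenever \<open>u\<close> and \<open>v\<close> lie
  in one cell, and reflect into a countable subfamily \<open>\<A>\<close>. If \<open>V\<close> is any member and \<open>y\<close> imitates \<open>x V\<close>,
  then \<open>x U \<otimes> inv y \<otimes> x V\<close> lies in \<open>U\<close> for all \<open>U \<in> \<A>\<close>, and it lies in \<open>V\<close> as soon as \<open>x U\<close> is close to
  \<open>y\<close>, which happens for some \<open>U \<in> \<A>\<close>. Disjointness leaves only \<open>V = U \<in> \<A>\<close>.
\<close>
lemma countable_disjoint_open_meeting_compact:
  assumes reg: "regular_space T" and Z: "compactin T Z"
    and open_V: "\<And>V. V \<in> \<V> \<Longrightarrow> openin T V" and meets: "\<And>V. V \<in> \<V> \<Longrightarrow> V \<inter> Z \<noteq> {}"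
    and disj: "pairwise disjnt \<V>"
  shows "countable \<V>"
proof -
  have ZG: "Z \<subseteq> carrier G"
    using compactin_subset_topspace[OF Z] by (simp add: topspace_eq_carrier)
  have "\<forall>V\<in>\<V>. \<exists>x. x \<in> V \<inter> Z" using meets by blast
  then obtain x where x: "\<And>V. V \<in> \<V> \<Longrightarrow> x V \<in> V" "\<And>V. V \<in> \<V> \<Longrightarrow> x V \<in> Z"
    by (metis IntD1 IntD2)
  then have xG: "x V \<in> carrier G" if "V \<in> \<V>" for V using ZG that by blast
  have "\<exists>E. finite E \<and> (\<forall>c\<in>E. closedin T c \<and> (\<forall>u\<in>c. \<forall>v\<in>c. x V \<otimes> (inv u \<otimes> v) \<in> V)) \<and> Z \<subseteq> \<Union>E"
    if V: "V \<in> \<V>" for V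
  proof -
    define W where "W = {w \<in> carrier G. x V \<otimes> w \<in> V}"
    have W: "openin T W" "\<one> \<in> W"
      using open_left_preimage[OF xG[OF V] open_V[OF V]] x[OF V] xG[OF V] by (auto simp: W_def)
    have "\<exists>A. openin T A \<and> z \<in> A \<and> (\<forall>u\<in>T closure_of A. \<forall>v\<in>T closure_of A. inv u \<otimes> v \<in> W)"
      if z: "z \<in> Z" for z
    proof -
      have zG: "z \<in> topspace T" and 1: "inv z \<otimes> z \<in> W" 
        using z ZG W by (auto simp: topspace_eq_carrier)
      obtain A B where AB: "openin T A" "openin T B" "z \<in> A" "z \<in> B"
        "\<And>a b. a \<in> A \<Longrightarrow> b \<in> B \<Longrightarrow> inv a \<otimes> b \<in> W"
        using continuous_map_prod_neighbourhoods[OF continuous_left_quotient W(1) zG zG 1] by blast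
      then obtain A' where "openin T A'" "z \<in> A'" "T closure_of A' \<subseteq> A \<inter> B"
        using regular_space_shrink[OF reg, of "A \<inter> B" z] by blast
      then show ?thesis using AB(5) by blast
    qed
    then obtain A where A: "\<And>z. z \<in> Z \<Longrightarrow> openin T (A z)" "\<And>z. z \<in> Z \<Longrightarrow> z \<in> A z"
      "\<And>z u v. z \<in> Z \<Longrightarrow> u \<in> T closure_of A z \<Longrightarrow> v \<in> T closure_of A z \<Longrightarrow> inv u \<otimes> v \<in> W"
      by metis
    obtain \<F> where \<F>: "finite \<F>" "\<F> \<subseteq> A ` Z" "Z \<subseteq> \<Union>\<F>"
      using compactinD[OF Z, of "A ` Z"] A(1,2) by blast
    have "C \<subseteq> T closure_of C" if "C \<in> \<F>" for C
    proof -
      have "openin T C" using that \<F>(2) A(1) by blast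
      then show ?thesis by (intro closure_of_subset openin_subset)
    qed
    then have "Z \<subseteq> \<Union>((\<lambda>C. T closure_of C) ` \<F>)" using \<F>(3) by blast
    moreover have "x V \<otimes> (inv u \<otimes> v) \<in> V"
      if "C \<in> \<F>" "u \<in> T closure_of C" "v \<in> T closure_of C" for C u v
    proof -
      have "inv u \<otimes> v \<in> W" using that A(3) \<F>(2) by blast
      then show ?thesis by (simp add: W_def)
    qed
    ultimately show ?thesis using \<F>(1) by (intro exI[of _ "(\<lambda>C. T closure_of C) ` \<F>"]) auto
  qed
  then have "\<forall>V\<in>\<V>. \<exists>E. finite E \<and>
      (\<forall>c\<in>E. closedin T c \<and> (\<forall>u\<in>c. \<forall>v\<in>c. x V \<otimes> (inv u \<otimes> v) \<in> V)) \<and> Z \<subseteq> \<Union>E"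
    by simp
  from bchoice[OF this] obtain E where E_all: "\<forall>V\<in>\<V>. finite (E V) \<and>
      (\<forall>c\<in>E V. closedin T c \<and> (\<forall>u\<in>c. \<forall>v\<in>c. x V \<otimes> (inv u \<otimes> v) \<in> V)) \<and> Z \<subseteq> \<Union>(E V)"
    by (rule exE)
  have E: "finite (E V)" "Z \<subseteq> \<Union>(E V)" "\<And>c. c \<in> E V \<Longrightarrow> closedin T c"
    "\<And>c u v. c \<in> E V \<Longrightarrow> u \<in> c \<Longrightarrow> v \<in> c \<Longrightarrow> x V \<otimes> (inv u \<otimes> v) \<in> V" if "V \<in> \<V>" for V
    using bspec[OF E_all that] by simp_all
  have "\<exists>\<A>\<subseteq>\<V>. countable \<A> \<and>
      (\<forall>V\<in>\<V>. \<exists>y\<in>T closure_of (x ` \<A>) \<inter> Z. \<forall>U\<in>\<A>. \<exists>c\<in>E U. y \<in> c \<and> x V \<in> c)"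
    by (rule countable_reflection_of_finite_closed_covers
        [OF Z compactin_imp_closedin[OF Hausdorff Z] x(2) E(1) E(3) E(2)])
  then obtain \<A> where \<A>: "\<A> \<subseteq> \<V>" "countable \<A>"
    "\<And>V. V \<in> \<V> \<Longrightarrow> \<exists>y\<in>T closure_of (x ` \<A>) \<inter> Z. \<forall>U\<in>\<A>. \<exists>c\<in>E U. y \<in> c \<and> x V \<in> c"
    by (elim exE conjE) metis
  have "V \<in> \<A>" if V: "V \<in> \<V>" for V
  proof -
    obtain y where y: "y \<in> T closure_of (x ` \<A>)" "y \<in> Z"
      "\<And>U. U \<in> \<A> \<Longrightarrow> \<exists>c\<in>E U. y \<in> c \<and> x V \<in> c"
      using \<A>(3)[OF V] by blast
    have yG: "y \<in> carrier G" using y(2) ZG by blast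
    \<comment> \<open>The points \<open>u\<close> so close to \<open>y\<close> that \<open>u \<otimes> inv y \<otimes> x V\<close> still lies in \<open>V\<close>.\<close>
    define O' where "O' = {u \<in> carrier G. u \<otimes> inv y \<in> {w \<in> carrier G. w \<otimes> x V \<in> V}}"
    have "openin T O'"
      unfolding O'_def using yG xG[OF V] open_V[OF V] by (intro open_right_preimage) auto
    moreover have "y \<in> O'" using yG xG[OF V] x(1)[OF V] by (simp add: O'_def)
    ultimately obtain U where U: "U \<in> \<A>" "x U \<in> O'"
      using y(1) unfolding in_closure_of by blast
    then have UV: "U \<in> \<V>" using \<A>(1) by blast
    obtain c where "c \<in> E U" "y \<in> c" "x V \<in> c" using y(3)[OF U(1)] by blast
    then have "x U \<otimes> (inv y \<otimes> x V) \<in> U" using E(4)[OF UV] y(2) by blast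
    moreover have "x U \<otimes> (inv y \<otimes> x V) \<in> V"
      using U(2) xG[OF V] xG[OF UV] yG by (simp add: O'_def m_assoc)
    ultimately have "U = V"
      using disj UV V by (auto simp: pairwise_def disjnt_def)
    then show ?thesis using U(1) by simp
  qed
  then have "\<V> \<subseteq> \<A>" by (rule subsetI)
  then show ?thesis using \<A>(2) by (rule countable_subset)
qed

text \<open>
  The neighbourhoods of \<open>\<one>\<close> are the sets \<open>P P\<^sup>-\<^sup>1\<close> with \<open>P\<close> in the \<open>\<pi>\<close>-base at \<open>p\<close>: they are open and contain \<open>\<one>\<close>
  whether or not \<open>P\<close> contains \<open>p\<close>, and they are small because \<open>p p\<^sup>-\<^sup>1 = \<one>\<close>.
\<close>
lemma countable_base_at_one_of_local_pi_base:
  assumes "countable \<P>" "p \<in> carrier G" and \<P>: "\<And>P. P \<in> \<P> \<Longrightarrow> openin T P" "\<And>P. P \<in> \<P> \<Longrightarrow> P \<noteq> {}"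
    and base: "\<And>U. openin T U \<Longrightarrow> p \<in> U \<Longrightarrow> \<exists>P\<in>\<P>. P \<subseteq> U"
  obtains \<B> where "countable \<B>" "base_at T \<one> \<B>"
proof -
  define W where "W P = (\<Union>b\<in>P. {g \<in> carrier G. g \<otimes> b \<in> P})" for P
  show ?thesis
  proof (rule that[of "W ` \<P>"])
    show "countable (W ` \<P>)" using assms(1) by blast
    show "base_at T \<one> (W ` \<P>)"
      unfolding base_at_def
    proof (intro conjI ballI allI impI)
      fix B assume "B \<in> W ` \<P>"
      then obtain P where P: "P \<in> \<P>" "B = W P" by blast
      have PG: "P \<subseteq> carrier G" using \<P>(1)[OF P(1)] by (rule open_subset_carrier)
      show "openin T B"
        unfolding P(2) W_def using \<P>(1)[OF P(1)] PG by (intro openin_Union) (auto intro!: open_right_preimage)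
      show "\<one> \<in> B"
        using \<P>(2)[OF P(1)] PG unfolding P(2) W_def by fastforce
    next
      fix U assume U: "openin T U \<and> \<one> \<in> U"
      then have "p \<otimes> inv p \<in> U" using assms(2) by simp
      then obtain A B where AB: "openin T A" "openin T B" "p \<in> A" "p \<in> B"
        "\<And>a b. a \<in> A \<Longrightarrow> b \<in> B \<Longrightarrow> a \<otimes> inv b \<in> U"
        using continuous_map_prod_neighbourhoods[OF continuous_right_quotient, of U p p] U assms(2)
        by (metis topspace_eq_carrier)
      then obtain P where P: "P \<in> \<P>" "P \<subseteq> A \<inter> B" using base[of "A \<inter> B"] by blast
      have PG: "P \<subseteq> carrier G" using \<P>(1)[OF P(1)] by (rule open_subset_carrier)
      have "g \<in> U" if "b \<in> P" "g \<in> carrier G" "g \<otimes> b \<in> P" for g b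
      proof -
        have "(g \<otimes> b) \<otimes> inv b \<in> U" using AB(5) P(2) that by blast
        moreover have "(g \<otimes> b) \<otimes> inv b = g" using that PG by (auto simp: m_assoc)
        ultimately show ?thesis by simp
      qed
      then have "W P \<subseteq> U" by (auto simp: W_def)
      then show "\<exists>B\<in>W ` \<P>. B \<subseteq> U" using P(1) by blast
    qed
  qed
qed

lemma compact_times_neighbourhood_subset_open:
  assumes C: "compactin T C" and U: "openin T U" "C \<subseteq> U"
  obtains W where "openin T W" "\<one> \<in> W" "\<And>x w. x \<in> C \<Longrightarrow> w \<in> W \<Longrightarrow> x \<otimes> w \<in> U"
proof -
  have CG: "C \<subseteq> carrier G"
    using compactin_subset_topspace[OF C] by (simp add: topspace_eq_carrier)
  define \<A> where "\<A> = {A. openin T A \<and> (\<exists>B. openin T B \<and> \<one> \<in> B \<and> (\<forall>a\<in>A. \<forall>b\<in>B. a \<otimes> b \<in> U))}"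
  have "x \<in> \<Union>\<A>" if "x \<in> C" for x
  proof -
    have xG: "x \<in> carrier G" using that CG by blast
    then have "x \<in> topspace T" "x \<otimes> \<one> \<in> U" using that U(2) by (auto simp: topspace_eq_carrier)
    then obtain A B where AB: "openin T A" "openin T B" "x \<in> A" "\<one> \<in> B"
      "\<And>a b. a \<in> A \<Longrightarrow> b \<in> B \<Longrightarrow> a \<otimes> b \<in> U"
      using continuous_map_prod_neighbourhoods[OF continuous_mult U(1) _ one_topspace] by metis
    have "A \<in> \<A>"
      unfolding \<A>_def using AB by (intro CollectI conjI exI[of _ B] ballI)
    then show ?thesis using AB(3) by (rule UnionI)
  qed
  then have "C \<subseteq> \<Union>\<A>" by (rule subsetI)
  moreover have "openin T A" if "A \<in> \<A>" for A using that by (simp add: \<A>_def)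
  ultimately have "\<exists>\<F>. finite \<F> \<and> \<F> \<subseteq> \<A> \<and> C \<subseteq> \<Union>\<F>"
    by (intro compactinD[OF C])
  then obtain \<F> where \<F>: "finite \<F>" "\<F> \<subseteq> \<A>" "C \<subseteq> \<Union>\<F>"
    by (elim exE conjE)
  have "\<forall>A\<in>\<F>. \<exists>B. openin T B \<and> \<one> \<in> B \<and> (\<forall>a\<in>A. \<forall>b\<in>B. a \<otimes> b \<in> U)"
    using \<F>(2) by (auto simp: \<A>_def)
  from bchoice[OF this] obtain B
    where B: "\<forall>A\<in>\<F>. openin T (B A) \<and> \<one> \<in> B A \<and> (\<forall>a\<in>A. \<forall>b\<in>B A. a \<otimes> b \<in> U)"
    by (rule exE)
  define W where "W = \<Inter>(insert (topspace T) (B ` \<F>))"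
  have "openin T W"
    unfolding W_def using \<F>(1) B by (intro openin_Inter) auto
  moreover have "\<one> \<in> W" using B one_topspace by (auto simp: W_def)
  moreover have "x \<otimes> w \<in> U" if "x \<in> C" "w \<in> W" for x w
  proof -
    obtain A where "A \<in> \<F>" "x \<in> A" using \<F>(3) \<open>x \<in> C\<close> by blast
    moreover from this have "w \<in> B A" using \<open>w \<in> W\<close> by (simp add: W_def)
    ultimately show ?thesis using B by blast
  qed
  ultimately show ?thesis using that by blast
qed

lemma open_translates_union:
  assumes "S \<subseteq> carrier G" "openin T W"
  shows "openin T (\<Union>x\<in>S. {g \<in> carrier G. inv x \<otimes> g \<in> W})"
  using assms by (intro openin_Union) (auto intro!: open_left_preimage)

text \<open>
  The left translates of the basic neighbourhoods of \<open>\<one>\<close> by the elements of \<open>D\<close> form a base.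
\<close>
lemma second_countable_of_dense_and_base_at_one:
  assumes D: "countable D" "D \<subseteq> carrier G" "T closure_of D = topspace T"
    and \<B>: "countable \<B>" "base_at T \<one> \<B>"
  shows "second_countable T"
proof -
  define N where "N d W = {g \<in> carrier G. inv d \<otimes> g \<in> W}" for d W
  have \<B>_open: "openin T W" if "W \<in> \<B>" for W using \<B>(2) that by (auto simp: base_at_def)
  have N_open: "openin T (N d W)" if "d \<in> D" "W \<in> \<B>" for d W
    unfolding N_def using that D(2) \<B>_open by (intro open_left_preimage) auto
  have "\<exists>d\<in>D. \<exists>W\<in>\<B>. x \<in> N d W \<and> N d W \<subseteq> U" if U: "openin T U" "x \<in> U" for U x
  proof -
    have xG: "x \<in> carrier G" using U open_subset_carrier by blast
    define U' where "U' = {u \<in> carrier G. x \<otimes> u \<in> U}"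
    have "openin T U'" "\<one> \<otimes> \<one> \<in> U'"
      using open_left_preimage[OF xG U(1)] xG U(2) by (auto simp: U'_def)
    then obtain A B where AB: "openin T A" "openin T B" "\<one> \<in> A" "\<one> \<in> B"
        "\<And>a b. a \<in> A \<Longrightarrow> b \<in> B \<Longrightarrow> a \<otimes> b \<in> U'"
      using continuous_map_prod_neighbourhoods[OF continuous_mult _ one_topspace one_topspace]
      by metis
    then have "openin T (A \<inter> B) \<and> \<one> \<in> A \<inter> B" by auto
    then obtain W where W: "W \<in> \<B>" "W \<subseteq> A \<inter> B"
      using \<B>(2) unfolding base_at_def by meson
    have W1: "openin T W" "\<one> \<in> W" using \<B>(2) W(1) by (auto simp: base_at_def)
    \<comment> \<open>Factor \<open>inv x \<otimes> g = (inv x \<otimes> d) \<otimes> (inv d \<otimes> g)\<close>, with \<open>d\<close> close to \<open>x\<close>.\<close>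
    define O' where "O' = {d \<in> carrier G. inv x \<otimes> d \<in> A} \<inter> {d \<in> topspace T. inv d \<in> {g \<in> carrier G. g \<otimes> x \<in> W}}"
    have "openin T O'"
      unfolding O'_def using xG AB(1) W1(1)
      by (intro openin_Int open_left_preimage openin_continuous_map_preimage[OF continuous_inv]
          open_right_preimage) auto
    moreover have "x \<in> O'" using xG AB(3) W1(2) by (simp add: O'_def topspace_eq_carrier)
    moreover have "x \<in> T closure_of D" using D(3) xG by (simp add: topspace_eq_carrier)
    ultimately obtain d where d: "d \<in> D" "d \<in> O'" unfolding in_closure_of by blast
    then have dG: "d \<in> carrier G" using D(2) by blast
    have "x \<in> N d W" using d(2) xG by (simp add: N_def O'_def)
    moreover have "g \<in> U" if "g \<in> N d W" for g
    proof -
      have gG: "g \<in> carrier G" and "inv d \<otimes> g \<in> B" using that W(2) by (auto simp: N_def)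
      moreover have "inv x \<otimes> d \<in> A" using d(2) by (simp add: O'_def)
      ultimately have "(inv x \<otimes> d) \<otimes> (inv d \<otimes> g) \<in> U'" using AB(5) by blast
      moreover have "(inv x \<otimes> d) \<otimes> (inv d \<otimes> g) = inv x \<otimes> g"
        using gG xG dG by (metis inv_closed inv_solve_left m_assoc m_closed)
      ultimately have "x \<otimes> (inv x \<otimes> g) \<in> U" by (simp add: U'_def)
      moreover have "x \<otimes> (inv x \<otimes> g) = g" using gG xG by (simp add: m_assoc[symmetric])
      ultimately show ?thesis by simp
    qed
    ultimately show ?thesis using d(1) W(1) by blast
  qed
  note N_base = this
  show ?thesis
    unfolding second_countable_def
  proof (intro exI[of _ "(\<lambda>(d, W). N d W) ` (D \<times> \<B>)"] conjI ballI allI impI)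
    show "countable ((\<lambda>(d, W). N d W) ` (D \<times> \<B>))" using D(1) \<B>(1) by blast
    show "openin T V" if "V \<in> (\<lambda>(d, W). N d W) ` (D \<times> \<B>)" for V using that N_open by auto
    show "\<exists>V\<in>(\<lambda>(d, W). N d W) ` (D \<times> \<B>). x \<in> V \<and> V \<subseteq> U" if "openin T U \<and> x \<in> U" for U x
      using N_base[of U x] that by fastforce
  qed
qed

end

section \<open>Remainders with a base of countable order\<close>

locale group_with_BCO_remainder = topological_group +
  fixes K :: "'a topology"
  assumes not_locally_compact: "\<not> locally_compact_space T"
    and compactification: "Hausdorff_compactification T K"
    and BCO_remainder: "has_BCO (subtopology K (topspace K - topspace T))"
begin

abbreviation remainder :: "'a set" where
  "remainder \<equiv> topspace K - topspace T"

lemma compact_K: "compact_space K"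
  and Hausdorff_K: "Hausdorff_space K"
  and group_subset: "topspace T \<subseteq> topspace K"
  and subtopology_group: "subtopology K (topspace T) = T"
  and group_dense: "K closure_of topspace T = topspace K"
  using compactification by (auto simp: Hausdorff_compactification_def)

lemma regular_K: "regular_space K"
  using compact_K Hausdorff_K by (rule compact_Hausdorff_imp_regular_space)

lemma regular_group: "regular_space T"
  using regular_space_subtopology[OF regular_K, of "topspace T"] by (simp add: subtopology_group)

lemma openin_group: "openin T U \<longleftrightarrow> (\<exists>V. openin K V \<and> U = V \<inter> topspace T)"
  using openin_subtopology[of K "topspace T" U] by (simp add: subtopology_group)

lemma compactin_group: "compactin T C \<longleftrightarrow> compactin K C \<and> C \<subseteq> topspace T"
  using compactin_subtopology[of K "topspace T" C] by (simp add: subtopology_group)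

lemma open_meets_group:
  assumes "openin K V" "V \<noteq> {}"
  shows "V \<inter> topspace T \<noteq> {}"
  using open_subset_closure_of_trace[OF group_dense assms(1)] assms(2) by auto

text \<open>
  An open subset of \<open>K\<close> that misses the remainder contains the closure of a smaller one, which is a
  compact subset of the group with interior points.
\<close>
lemma remainder_dense: "K closure_of remainder = topspace K"
proof -
  have "x \<in> K closure_of remainder" if x: "x \<in> topspace K" for x
  proof (rule ccontr)
    assume "x \<notin> K closure_of remainder"
    then obtain U where U: "x \<in> U" "openin K U" "\<not> (\<exists>y. y \<in> remainder \<and> y \<in> U)"
      using x unfolding in_closure_of by auto
    then have UT: "U \<subseteq> topspace T" using openin_subset by fastforce
    obtain V where V: "openin K V" "x \<in> V" "K closure_of V \<subseteq> U"
      using regular_space_shrink[OF regular_K U(2,1)] .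
    have VU: "V \<subseteq> K closure_of V" using closure_of_subset[OF openin_subset[OF V(1)]] .
    have "compactin K (K closure_of V)"
      by (rule closedin_compact_space[OF compact_K closedin_closure_of])
    then have "compactin T (K closure_of V)"
      using V(3) UT by (auto simp: compactin_group)
    moreover have "V = V \<inter> topspace T" using VU V(3) UT by blast
    then have "openin T V" using V(1) unfolding openin_group by blast
    ultimately show False
      using not_locally_compact_imp_nowhere_locally_compact[OF not_locally_compact _ V(2)] VU by blast
  qed
  then show ?thesis using closure_of_subset_topspace[of K remainder] by blast
qed

lemma open_meets_remainder:
  assumes "openin K V" "V \<noteq> {}"
  shows "V \<inter> remainder \<noteq> {}"
  using open_subset_closure_of_trace[OF remainder_dense assms(1)] assms(2) by auto

lemma topspace_remainder: "topspace (subtopology K remainder) = remainder"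
  by auto

lemma remainder_first_countable:
  assumes "y \<in> remainder"
  shows "\<exists>V :: nat \<Rightarrow> 'a set. base_at K y (range V)"
proof -
  obtain b :: "nat \<Rightarrow> 'a set" where b: "base_at (subtopology K remainder) y (range b)"
    using has_BCO_decreasing_base_at[OF BCO_remainder, of y] assms
    unfolding topspace_remainder by blast
  then have "\<forall>n. \<exists>V. openin K V \<and> b n = V \<inter> remainder"
    unfolding base_at_def by (simp add: openin_subtopology)
  from choice[OF this] obtain V where V: "\<forall>n. openin K (V n) \<and> b n = V n \<inter> remainder"
    by (rule exE)
  have "base_at K y (range V)"
    using V by (intro base_at_dense_extension[OF regular_K remainder_dense b]) auto
  then show ?thesis by blast
qed

text \<open>
  A point \<open>y\<close> of the remainder in the closure of \<open>C\<close> would give a countable open cover of \<open>C\<close> without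
  finite subcover: the complements of the closures of the members of a countable base at \<open>y\<close>.
\<close>
lemma countably_compact_imp_closedin_compactification:
  assumes C: "closedin T C" "countably_compactin T C"
  shows "closedin K C"
proof -
  have CT: "C \<subseteq> topspace T" using C(1) by (rule closedin_subset)
  have CK: "C \<subseteq> topspace K" using CT group_subset by (rule order_trans)
  have "K closure_of C \<subseteq> C"
  proof
    fix y assume y: "y \<in> K closure_of C"
    show "y \<in> C"
    proof (rule ccontr)
      assume "y \<notin> C"
      have "T closure_of C = C" using C(1) by (simp add: closure_of_closedin)
      then have "topspace T \<inter> K closure_of C = C"
        using closure_of_subtopology_subset[of K "topspace T" C] closure_of_subtopology[of K "topspace T" C] CT
        by (simp add: subtopology_group Int_absorb1)
      then have "y \<in> remainder" using y \<open>y \<notin> C\<close> closure_of_subset_topspace[of K C] by blast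
      then obtain V :: "nat \<Rightarrow> 'a set" where "base_at K y (range V)"
        using remainder_first_countable by blast
      then have V: "\<And>n. openin K (V n)" "\<And>n. y \<in> V n"
        and V_base: "\<And>U. openin K U \<Longrightarrow> y \<in> U \<Longrightarrow> \<exists>n. V n \<subseteq> U"
        unfolding base_at_def by auto
      define O' where "O' n = topspace T - K closure_of (V n)" for n
      have "O' n = (topspace K - K closure_of (V n)) \<inter> topspace T" for n
        unfolding O'_def using group_subset by auto
      then have "openin T (O' n)" for n
        unfolding openin_group by (intro exI[of _ "topspace K - K closure_of (V n)"]) auto
      moreover have "C \<subseteq> \<Union>(range O')"
      proof
        fix c assume c: "c \<in> C"
        then have "c \<noteq> y" "c \<in> topspace K" "y \<in> topspace K"
          using \<open>y \<notin> C\<close> CK V openin_subset[of K "V 0"] by auto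
        then obtain A B where AB: "openin K A" "openin K B" "c \<in> A" "y \<in> B" "disjnt A B"
          using Hausdorff_K unfolding Hausdorff_space_def by metis
        obtain n where "V n \<subseteq> B" using V_base[OF AB(2,4)] by (rule exE)
        then have "A \<inter> V n = {}" using AB(5) by (auto simp: disjnt_def)
        then have "c \<notin> K closure_of (V n)" using AB(1,3) unfolding in_closure_of by blast
        then have "c \<in> O' n" using c CT by (auto simp: O'_def)
        then show "c \<in> \<Union>(range O')" by blast
      qed
      ultimately have "\<exists>\<V>. finite \<V> \<and> \<V> \<subseteq> range O' \<and> C \<subseteq> \<Union>\<V>"
        using C(2) unfolding countably_compactin_def by (simp add: image_iff)
      then obtain \<V> where \<V>: "finite \<V>" "\<V> \<subseteq> range O'" "C \<subseteq> \<Union>\<V>" by (elim exE conjE)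
      then obtain s where s: "finite s" "\<V> = O' ` s"
        by (metis finite_subset_image subset_UNIV)
      define W where "W = \<Inter>(insert (topspace K) (V ` s))"
      have "openin K W" unfolding W_def using s(1) V(1) by (intro openin_Inter) auto
      moreover have "y \<in> W" using V openin_subset[of K "V 0"] by (auto simp: W_def)
      ultimately obtain c where c: "c \<in> C" "c \<in> W" using y unfolding in_closure_of by blast
      then obtain n where n: "n \<in> s" "c \<in> O' n" using \<V>(3) s(2) by blast
      have "c \<in> V n" using c(2) n(1) by (auto simp: W_def)
      then have "c \<in> K closure_of (V n)"
        using closure_of_subset[OF openin_subset[OF V(1)[of n]]] by blast
      then show False using n(2) by (simp add: O'_def)
    qed
  qed
  then show ?thesis
    using closure_of_subset[OF CK] closedin_closure_of[of K C] by (metis subset_antisym)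
qed

text \<open>
  The countable bases at the points of \<open>D\<close> form together a countable \<open>\<pi>\<close>-base at \<open>p\<close>.
\<close>
lemma countable_base_at_one_if_group_meets_separable_closure:
  assumes D: "countable D" "D \<subseteq> remainder" and p: "p \<in> K closure_of D" "p \<in> topspace T"
  shows "\<exists>\<B>. countable \<B> \<and> base_at T \<one> \<B>"
proof -
  have "\<forall>d\<in>D. \<exists>V :: nat \<Rightarrow> 'a set. base_at K d (range V)"
    using D(2) remainder_first_countable by blast
  from bchoice[OF this] obtain V :: "'a \<Rightarrow> nat \<Rightarrow> 'a set"
    where V: "\<forall>d\<in>D. base_at K d (range (V d))" by (rule exE)
  have V_open: "openin K (V d n)" "d \<in> V d n" if "d \<in> D" for d n
    using V that unfolding base_at_def by auto
  define \<P> where "\<P> = (\<lambda>(d, n). V d n \<inter> topspace T) ` (D \<times> UNIV)"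
  have "countable \<P>" using D(1) by (simp add: \<P>_def)
  moreover have "p \<in> carrier G" using p(2) topspace_eq_carrier by simp
  moreover have "openin T P" if "P \<in> \<P>" for P
    using that V_open(1) unfolding \<P>_def openin_group by auto
  moreover have "P \<noteq> {}" if "P \<in> \<P>" for P
  proof -
    obtain d n where "d \<in> D" "P = V d n \<inter> topspace T"
      using \<open>P \<in> \<P>\<close> by (auto simp: \<P>_def)
    then show ?thesis using open_meets_group[of "V d n"] V_open[of d n] by auto
  qed
  moreover have "\<exists>P\<in>\<P>. P \<subseteq> U" if "openin T U" "p \<in> U" for U
  proof -
    obtain U' where U': "openin K U'" "U = U' \<inter> topspace T"
      using \<open>openin T U\<close> unfolding openin_group by (elim exE conjE)
    then obtain d where d: "d \<in> D" "d \<in> U'"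
      using p(1) \<open>p \<in> U\<close> unfolding in_closure_of by auto
    have "base_at K d (range (V d))" using V d(1) by (rule bspec)
    then have "\<exists>P\<in>range (V d). P \<subseteq> U'"
      using U'(1) d(2) unfolding base_at_def by simp
    then obtain n where "V d n \<subseteq> U'" by auto
    then have "V d n \<inter> topspace T \<subseteq> U" using U'(2) by blast
    then show ?thesis using d(1) unfolding \<P>_def by force
  qed
  ultimately show ?thesis
    using countable_base_at_one_of_local_pi_base[of \<P> p] by metis
qed

text \<open>
  What an open cover of the remainder leaves uncovered is a compact subset \<open>C\<close> of the group. The sets \<open>C W\<close>, for
  \<open>W\<close> in the countable base at \<open>\<one>\<close>, extend to open subsets of \<open>K\<close> with intersection \<open>C\<close>. Their
  complements are compact, cover the remainder, and each needs only finitely many members of the cover.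
\<close>
lemma remainder_Lindelof_if_countable_base_at_one:
  assumes \<B>: "countable \<B>" "base_at T \<one> \<B>"
  shows "Lindelof_space (subtopology K remainder)"
proof -
  have \<B>_open: "openin T W" "\<one> \<in> W" if "W \<in> \<B>" for W
    using \<B>(2) that by (auto simp: base_at_def)
  have "\<exists>\<V>. countable \<V> \<and> \<V> \<subseteq> \<U> \<and> remainder \<subseteq> \<Union>\<V>"
    if \<U>_open: "\<forall>U\<in>\<U>. openin K U" and cover: "remainder \<subseteq> \<Union>\<U>" for \<U>
  proof -
    define C where "C = topspace K - \<Union>\<U>"
    have C_closed: "closedin K C" unfolding C_def using \<U>_open by (intro closedin_diff) auto
    have CT: "C \<subseteq> topspace T" using cover by (auto simp: C_def)
    then have CG: "C \<subseteq> carrier G" by (simp add: topspace_eq_carrier)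
    have C_compact: "compactin T C"
      using closedin_compact_space[OF compact_K C_closed] CT by (simp add: compactin_group)
    define N where "N W = (\<Union>x\<in>C. {g \<in> carrier G. inv x \<otimes> g \<in> W})" for W
    have "\<forall>W\<in>\<B>. \<exists>P. openin K P \<and> N W = P \<inter> topspace T"
      using open_translates_union[OF CG \<B>_open(1)] unfolding openin_group N_def by simp
    from bchoice[OF this] obtain P where P: "\<forall>W\<in>\<B>. openin K (P W) \<and> N W = P W \<inter> topspace T"
      by (rule exE)
    have "\<exists>\<V>. finite \<V> \<and> \<V> \<subseteq> \<U> \<and> topspace K - P W \<subseteq> \<Union>\<V>" if W: "W \<in> \<B>" for W
    proof -
      have "x \<in> N W" if "x \<in> C" for x
      proof -
        have "x \<in> carrier G" using that CG by blast
        then show ?thesis using that \<B>_open(2)[OF W] by (auto simp: N_def intro!: bexI[of _ x])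
      qed
      then have "C \<subseteq> N W" by (rule subsetI)
      then have "topspace K - P W \<subseteq> \<Union>\<U>" using P W by (auto simp: C_def)
      moreover have "compactin K (topspace K - P W)"
        using P W by (intro closedin_compact_space[OF compact_K]) auto
      ultimately show ?thesis using \<U>_open by (intro compactinD) auto
    qed
    then have "\<forall>W\<in>\<B>. \<exists>\<V>. finite \<V> \<and> \<V> \<subseteq> \<U> \<and> topspace K - P W \<subseteq> \<Union>\<V>" by blast
    from bchoice[OF this] obtain \<V>
      where \<V>: "\<forall>W\<in>\<B>. finite (\<V> W) \<and> \<V> W \<subseteq> \<U> \<and> topspace K - P W \<subseteq> \<Union>(\<V> W)" by (rule exE)
    have "y \<in> \<Union>(\<Union>W\<in>\<B>. \<V> W)" if y: "y \<in> remainder" for y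
    proof -
      have "openin K (topspace K - C)" "y \<in> topspace K - C"
        using C_closed y CT by auto
      then obtain M where M: "openin K M" "y \<in> M" "K closure_of M \<subseteq> topspace K - C"
        using regular_space_shrink[OF regular_K] by metis
      define U where "U = topspace K - K closure_of M"
      have U: "openin K U" "C \<subseteq> U" using M(3) CT group_subset by (auto simp: U_def)
      have "U \<inter> M = {}"
        using closure_of_subset[OF openin_subset[OF M(1)]] by (auto simp: U_def)
      then have yU: "y \<notin> K closure_of U" using M(1,2) unfolding in_closure_of by blast
      have "openin T (U \<inter> topspace T)" using U(1) unfolding openin_group by blast
      moreover have "C \<subseteq> U \<inter> topspace T" using U(2) CT by simp
      ultimately obtain W' where W': "openin T W'" "\<one> \<in> W'"
        "\<And>x w. x \<in> C \<Longrightarrow> w \<in> W' \<Longrightarrow> x \<otimes> w \<in> U \<inter> topspace T"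
        using compact_times_neighbourhood_subset_open[OF C_compact] by metis
      then obtain W where W: "W \<in> \<B>" "W \<subseteq> W'" using \<B>(2) unfolding base_at_def by metis
      have "g \<in> U" if "x \<in> C" "g \<in> carrier G" "inv x \<otimes> g \<in> W" for x g
      proof -
        have "x \<otimes> (inv x \<otimes> g) \<in> U" using W'(3)[OF \<open>x \<in> C\<close>] that W(2) by blast
        moreover have "x \<otimes> (inv x \<otimes> g) = g" using that CG by (auto simp: m_assoc[symmetric])
        ultimately show ?thesis by simp
      qed
      then have "N W \<subseteq> U" by (auto simp: N_def)
      have PW: "openin K (P W)" "N W = P W \<inter> topspace T" using P W(1) by auto
      have "P W \<subseteq> K closure_of (P W \<inter> topspace T)"
        using open_subset_closure_of_trace[OF group_dense PW(1)] .
      also have "\<dots> \<subseteq> K closure_of U"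
        using \<open>N W \<subseteq> U\<close> PW(2) by (intro closure_of_mono) simp
      finally have "y \<notin> P W" using yU by (metis subsetD)
      moreover have "topspace K - P W \<subseteq> \<Union>(\<V> W)" using bspec[OF \<V> W(1)] by simp
      ultimately have "y \<in> \<Union>(\<V> W)" using y by (metis DiffD1 DiffI subsetD)
      then show ?thesis using W(1) by auto
    qed
    then have "remainder \<subseteq> \<Union>(\<Union>W\<in>\<B>. \<V> W)" by (rule subsetI)
    moreover have "countable (\<Union>W\<in>\<B>. \<V> W)"
      using \<B>(1) \<V> by (intro countable_UN) (auto simp: countable_finite)
    moreover have "(\<Union>W\<in>\<B>. \<V> W) \<subseteq> \<U>" using \<V> by (intro UN_least) simp
    ultimately show ?thesis by (intro exI[of _ "\<Union>W\<in>\<B>. \<V> W"] conjI)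
  qed
  then have "\<forall>\<U>. (\<forall>U\<in>\<U>. openin K U) \<and> remainder \<subseteq> \<Union>\<U> \<longrightarrow>
      (\<exists>\<V>. countable \<V> \<and> \<V> \<subseteq> \<U> \<and> remainder \<subseteq> \<Union>\<V>)"
    by (intro allI impI) (elim conjE)
  then show ?thesis
    by (rule Lindelof_space_subtopology_subset[OF Diff_subset, THEN iffD2])
qed

text \<open>
  The remainder has a countable base, whose extension to \<open>K\<close> makes the group separable. So the
  group has a countable base too, and the extensions of the two bases form a base of \<open>K\<close>.
\<close>
lemma second_countable_if_countable_base_at_one:
  assumes \<B>: "countable \<B>" "base_at T \<one> \<B>"
  shows "second_countable K"
proof -
  have "Lindelof_space (subtopology (subtopology K remainder) remainder)"
    using remainder_Lindelof_if_countable_base_at_one[OF \<B>] by (simp add: subtopology_subtopology)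
  then obtain \<C> where \<C>: "countable \<C>" "\<And>b. b \<in> \<C> \<Longrightarrow> openin (subtopology K remainder) b"
    "\<And>x U. x \<in> remainder \<Longrightarrow> openin (subtopology K remainder) U \<Longrightarrow> x \<in> U \<Longrightarrow> \<exists>b\<in>\<C>. x \<in> b \<and> b \<subseteq> U"
    using BCO_Lindelof_countable_base[OF regular_space_subtopology[OF regular_K] BCO_remainder,
        of remainder] unfolding topspace_remainder by (metis order_refl)
  have "\<exists>b\<in>\<C>. x \<in> b \<and> b \<subseteq> U" if "openin (subtopology K remainder) U" "x \<in> U" for U x
    using \<C>(3)[OF _ that] openin_subset[OF that(1)] that(2) unfolding topspace_remainder by blast
  then have "second_countable (subtopology K remainder)"
    unfolding second_countable_def using \<C>(1,2) by (intro exI[of _ \<C>]) simp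
  from dense_extension_of_countable_base[OF regular_K remainder_dense this]
  obtain \<V> where \<V>: "countable \<V>" "\<forall>V\<in>\<V>. openin K V"
    "\<forall>U x. openin K U \<and> x \<in> U \<and> x \<in> remainder \<longrightarrow> (\<exists>V\<in>\<V>. x \<in> V \<and> V \<subseteq> U)"
    by (elim exE conjE)
  define d where "d V = (SOME x. x \<in> V \<inter> topspace T)" for V
  define D where "D = d ` (\<V> - {{}})"
  have d: "d V \<in> V" "d V \<in> topspace T" if "V \<in> \<V>" "V \<noteq> {}" for V
  proof -
    have "\<exists>x. x \<in> V \<inter> topspace T"
      using open_meets_group[of V] \<V>(2) that by auto
    from someI_ex[OF this] show "d V \<in> V" "d V \<in> topspace T" by (simp_all add: d_def)
  qed
  have DT: "D \<subseteq> topspace T" using d(2) by (auto simp: D_def)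
  have "x \<in> T closure_of D" if x: "x \<in> topspace T" for x
    unfolding in_closure_of
  proof (intro conjI x allI impI)
    fix U assume U: "x \<in> U \<and> openin T U"
    then obtain U' where U': "openin K U'" "U = U' \<inter> topspace T"
      unfolding openin_group by auto
    then have "U' \<noteq> {}" using U by auto
    then obtain y where y: "y \<in> U'" "y \<in> remainder"
      using open_meets_remainder[OF U'(1)] by auto
    then obtain V where V: "V \<in> \<V>" "y \<in> V" "V \<subseteq> U'"
      using \<V>(3) U'(1) by metis
    then have "d V \<in> D" "d V \<in> U" using d[of V] U'(2) by (auto simp: D_def)
    then show "\<exists>y. y \<in> D \<and> y \<in> U" by blast
  qed
  then have "T closure_of D = topspace T"
    using closure_of_subset_topspace[of T D] by blast
  moreover have "countable D" using \<V>(1) by (simp add: D_def)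
  ultimately have "second_countable T"
    using second_countable_of_dense_and_base_at_one[OF _ _ _ \<B>, of D] DT
    by (simp add: topspace_eq_carrier)
  then have "second_countable (subtopology K (topspace T))" by (simp add: subtopology_group)
  from dense_extension_of_countable_base[OF regular_K group_dense this]
  obtain \<W> where \<W>: "countable \<W>" "\<forall>V\<in>\<W>. openin K V"
    "\<forall>U x. openin K U \<and> x \<in> U \<and> x \<in> topspace T \<longrightarrow> (\<exists>V\<in>\<W>. x \<in> V \<and> V \<subseteq> U)"
    by (elim exE conjE)
  show ?thesis
    unfolding second_countable_def
  proof (intro exI[of _ "\<V> \<union> \<W>"] conjI ballI allI impI)
    show "countable (\<V> \<union> \<W>)" using \<V>(1) \<W>(1) by simp
    show "openin K V" if "V \<in> \<V> \<union> \<W>" for V using that \<V>(2) \<W>(2) by auto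
    show "\<exists>V\<in>\<V> \<union> \<W>. x \<in> V \<and> V \<subseteq> U" if U: "openin K U \<and> x \<in> U" for U x
    proof (cases "x \<in> topspace T")
      case True
      then have "\<exists>V\<in>\<W>. x \<in> V \<and> V \<subseteq> U" using \<W>(3) U by simp
      then show ?thesis by (simp add: bex_Un)
    next
      case False
      then have "x \<in> remainder" using U openin_subset by blast
      then have "\<exists>V\<in>\<V>. x \<in> V \<and> V \<subseteq> U" using \<V>(3) U by simp
      then show ?thesis by (simp add: bex_Un)
    qed
  qed
qed

end

section \<open>Remainders containing the closures of their countable subsets\<close>

text \<open>
  The case to be refuted for \<open>\<Sigma>\<close>-spaces: the remainder is \<open>\<omega>\<close>-bounded, the closure in \<open>K\<close> of a countable subset
  of the remainder being a compact subset of it.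
\<close>
locale group_with_omega_bounded_BCO_remainder = group_with_BCO_remainder +
  assumes countable_closure: "\<And>D. countable D \<Longrightarrow> D \<subseteq> remainder \<Longrightarrow> K closure_of D \<subseteq> remainder"
begin

text \<open>
  First countability of the remainder would not be enough here; the base of countable order gives a countable
  family of open sets that contains a base at every point of \<open>R\<close>.
\<close>
lemma compact_subset_of_remainder_separable:
  assumes R: "compactin K R" "R \<subseteq> remainder"
  shows "\<exists>D. countable D \<and> D \<subseteq> R \<and> R \<subseteq> K closure_of D"
proof -
  have "compact_space (subtopology K R)" using R(1) by (rule compact_space_subtopology)
  then have "Lindelof_space (subtopology K R)" by (rule compact_imp_Lindelof_space)
  moreover have "subtopology (subtopology K remainder) R = subtopology K R"
    using R(2) by (simp add: subtopology_subtopology Int_absorb1)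
  ultimately have L: "Lindelof_space (subtopology (subtopology K remainder) R)" by simp
  have R': "R \<subseteq> topspace (subtopology K remainder)" unfolding topspace_remainder by (rule R(2))
  obtain \<C> where \<C>: "countable \<C>" "\<And>b. b \<in> \<C> \<Longrightarrow> openin (subtopology K remainder) b"
    "\<And>x U. x \<in> R \<Longrightarrow> openin (subtopology K remainder) U \<Longrightarrow> x \<in> U \<Longrightarrow> \<exists>b\<in>\<C>. x \<in> b \<and> b \<subseteq> U"
    using BCO_Lindelof_countable_base[OF regular_space_subtopology[OF regular_K] BCO_remainder R' L]
    by metis
  define d where "d b = (SOME x. x \<in> b \<inter> R)" for b
  define D where "D = d ` {b \<in> \<C>. b \<inter> R \<noteq> {}}"
  have d: "d b \<in> b \<inter> R" if "b \<inter> R \<noteq> {}" for b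
    using that someI_ex[of "\<lambda>x. x \<in> b \<inter> R"] unfolding d_def by auto
  have "x \<in> K closure_of D" if x: "x \<in> R" for x
    unfolding in_closure_of
  proof (intro conjI allI impI)
    show "x \<in> topspace K" using x R(2) by blast
    fix U assume U: "x \<in> U \<and> openin K U"
    then have "openin (subtopology K remainder) (U \<inter> remainder)" "x \<in> U \<inter> remainder"
      using x R(2) by (auto simp: openin_subtopology)
    then obtain b where b: "b \<in> \<C>" "x \<in> b" "b \<subseteq> U \<inter> remainder" using \<C>(3)[OF x] by metis
    then have "b \<inter> R \<noteq> {}" using x by auto
    then have "d b \<in> D" "d b \<in> U" using d[of b] b by (auto simp: D_def)
    then show "\<exists>y. y \<in> D \<and> y \<in> U" by blast
  qed
  then have "R \<subseteq> K closure_of D" by (rule subsetI)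
  moreover have "countable D" using \<C>(1) by (simp add: D_def)
  moreover have "D \<subseteq> R" using d by (auto simp: D_def)
  ultimately show ?thesis by (intro exI[of _ D] conjI)
qed

text \<open>
  The set \<open>R n\<close> of points of \<open>K\<close> without a neighbourhood that meets only finitely many members of
  \<open>\<F> n\<close> is a compact subset of the remainder, hence separable. So all the sets \<open>R n\<close> lie in the closure \<open>L\<close> of one
  countable subset of the remainder, and \<open>L\<close> does not contain \<open>\<one>\<close>.
\<close>
lemma countably_many_locally_finite_families_near_one:
  fixes \<F> :: "nat \<Rightarrow> 'a set set"
  assumes lf: "\<And>n. locally_finite_in T (\<F> n)"
  shows "\<exists>\<Omega>. openin K \<Omega> \<and> \<one> \<in> \<Omega> \<and> (\<forall>n. finite {F\<in>\<F> n. F \<inter> K closure_of \<Omega> \<noteq> {}})"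
proof -
  define good where "good n V \<longleftrightarrow> openin K V \<and> finite {F\<in>\<F> n. F \<inter> V \<noteq> {}}" for n V
  define R where "R n = topspace K - \<Union>(Collect (good n))" for n
  have R_closed: "closedin K (R n)" for n
    unfolding R_def by (intro closedin_diff openin_Union) (auto simp: good_def)
  have "R n \<subseteq> remainder" for n
  proof -
    have "x \<in> \<Union>(Collect (good n))" if x: "x \<in> topspace T" for x
    proof -
      obtain V where V: "openin T V" "x \<in> V" "finite {F\<in>\<F> n. F \<inter> V \<noteq> {}}"
        using lf[of n] x unfolding locally_finite_in_def by metis
      obtain V' where V': "openin K V'" "V = V' \<inter> topspace T"
        using V(1) unfolding openin_group by (elim exE conjE)
      have "F \<subseteq> topspace T" if "F \<in> \<F> n" for F
        using lf[of n] that unfolding locally_finite_in_def by auto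
      then have "{F\<in>\<F> n. F \<inter> V' \<noteq> {}} \<subseteq> {F\<in>\<F> n. F \<inter> V \<noteq> {}}" using V'(2) by auto
      then have "finite {F\<in>\<F> n. F \<inter> V' \<noteq> {}}" using V(3) by (rule finite_subset)
      then have "good n V'" using V'(1) by (simp add: good_def)
      then show ?thesis using V(2) V'(2) by auto
    qed
    then show ?thesis unfolding R_def by auto
  qed
  then have "\<exists>D. countable D \<and> D \<subseteq> R n \<and> R n \<subseteq> K closure_of D" for n
    by (intro compact_subset_of_remainder_separable closedin_compact_space[OF compact_K R_closed])
  then have "\<forall>n. \<exists>D. countable D \<and> D \<subseteq> R n \<and> R n \<subseteq> K closure_of D" by (rule allI)
  from choice[OF this] obtain D where D: "\<forall>n. countable (D n) \<and> D n \<subseteq> R n \<and> R n \<subseteq> K closure_of (D n)"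
    by (rule exE)
  define L where "L = K closure_of (\<Union>n. D n)"
  have "(\<Union>n. D n) \<subseteq> remainder" using D \<open>\<And>n. R n \<subseteq> remainder\<close> by (meson UN_least order_trans)
  then have LY: "L \<subseteq> remainder" unfolding L_def using D by (intro countable_closure) auto
  have RL: "R n \<subseteq> L" for n
  proof -
    have "K closure_of (D n) \<subseteq> L" unfolding L_def by (intro closure_of_mono) auto
    then show ?thesis using D by (meson order_trans)
  qed
  have "openin K (topspace K - L)"
    unfolding L_def by (intro openin_diff openin_topspace closedin_closure_of)
  moreover have "\<one> \<in> topspace K - L" using one_topspace group_subset LY by auto
  ultimately obtain \<Omega> where \<Omega>: "openin K \<Omega>" "\<one> \<in> \<Omega>" "K closure_of \<Omega> \<subseteq> topspace K - L"
    by (rule regular_space_shrink[OF regular_K])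
  have "finite {F\<in>\<F> n. F \<inter> K closure_of \<Omega> \<noteq> {}}" for n
  proof (rule compact_meets_finitely_many)
    show "compactin K (K closure_of \<Omega>)"
      by (rule closedin_compact_space[OF compact_K closedin_closure_of])
    fix z assume "z \<in> K closure_of \<Omega>"
    then have "z \<in> \<Union>(Collect (good n))" using \<Omega>(3) RL[of n] by (auto simp: R_def)
    then show "\<exists>V. openin K V \<and> z \<in> V \<and> finite {F\<in>\<F> n. F \<inter> V \<noteq> {}}"
      by (auto simp: good_def)
  qed
  then show ?thesis using \<Omega>(1,2) by (intro exI[of _ \<Omega>] conjI allI)
qed

text \<open>
  Let \<open>Q\<close> be a closed neighbourhood of \<open>\<one>\<close> that only countably many members of the network meet. For a finite set
  \<open>s\<close> of such members, \<open>H s\<close> is the part of \<open>Q\<close> in the closures of all of them. The compact sets of the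
  required family are the \<open>H s\<close> that miss the remainder. If they did not cover the point \<open>x\<close> of
  some compact \<open>C\<close> in the given cover, then every \<open>H s\<close> with all members of \<open>s\<close> containing \<open>C\<close> would meet the
  countable set \<open>D\<close>. By compactness the closure of \<open>D\<close>, a subset of the remainder, would then contain a point of
  the intersection of these closures; but that intersection is contained in \<open>C\<close>.
\<close>
lemma Sigma_space_imp_locally_sigma_compact:
  assumes "Sigma_space T"
  shows "\<exists>\<Omega> \<Z>. openin K \<Omega> \<and> \<one> \<in> \<Omega> \<and> countable \<Z> \<and> (\<forall>Z\<in>\<Z>. compactin T Z) \<and>
    \<Omega> \<inter> topspace T \<subseteq> \<Union>\<Z>"
proof -
  obtain \<F> \<C> where \<F>: "sigma_locally_finite_in T \<F>"
    and \<C>: "\<forall>C\<in>\<C>. closedin T C \<and> countably_compactin T C" "\<Union>\<C> = topspace T"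
    and network: "\<forall>C\<in>\<C>. \<forall>U. openin T U \<and> C \<subseteq> U \<longrightarrow> (\<exists>F\<in>\<F>. C \<subseteq> F \<and> F \<subseteq> U)"
    using assms unfolding Sigma_space_def by (elim exE conjE)
  obtain \<G> :: "nat \<Rightarrow> 'a set set" where \<G>: "\<forall>n. locally_finite_in T (\<G> n)" "\<F> = (\<Union>n. \<G> n)"
    using \<F> unfolding sigma_locally_finite_in_def by (elim exE conjE)
  from countably_many_locally_finite_families_near_one[of \<G>] \<G>(1)
  obtain \<Omega> where \<Omega>: "openin K \<Omega>" "\<one> \<in> \<Omega>" "\<forall>n. finite {F\<in>\<G> n. F \<inter> K closure_of \<Omega> \<noteq> {}}"
    by auto
  define Q where "Q = K closure_of \<Omega>"
  have Q_closed: "closedin K Q" by (simp add: Q_def)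
  define \<F>Q where "\<F>Q = {F\<in>\<F>. F \<inter> Q \<noteq> {}}"
  have "\<F>Q = (\<Union>n. {F\<in>\<G> n. F \<inter> Q \<noteq> {}})" using \<G>(2) by (auto simp: \<F>Q_def)
  then have "countable \<F>Q" using \<Omega>(3) by (auto simp: Q_def countable_finite)
  then have S_countable: "countable {s. finite s \<and> s \<subseteq> \<F>Q}" by (rule countable_Collect_finite_subset)
  define H where "H s = \<Inter>(insert Q ((\<lambda>F. K closure_of F) ` s))" for s
  have H_closed: "closedin K (H s)" if "finite s" for s
    unfolding H_def using Q_closed that by (intro closedin_Inter) auto
  define y where "y s = (SOME z. z \<in> H s \<inter> remainder)" for s
  have y: "y s \<in> H s \<inter> remainder" if "H s \<inter> remainder \<noteq> {}" for s
    using that someI_ex[of "\<lambda>z. z \<in> H s \<inter> remainder"] unfolding y_def by auto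
  define D where "D = y ` {s. (finite s \<and> s \<subseteq> \<F>Q) \<and> H s \<inter> remainder \<noteq> {}}"
  have "D \<subseteq> remainder" using y by (auto simp: D_def)
  moreover have "countable D"
    unfolding D_def using S_countable by (rule countable_image[OF countable_subset, rotated]) auto
  ultimately have LY: "K closure_of D \<subseteq> remainder" by (intro countable_closure)
  define \<Z> where "\<Z> = H ` {s. (finite s \<and> s \<subseteq> \<F>Q) \<and> H s \<inter> remainder = {}}"
  have "countable \<Z>"
    unfolding \<Z>_def using S_countable by (rule countable_image[OF countable_subset, rotated]) auto
  moreover have "compactin T Z" if Z: "Z \<in> \<Z>" for Z
  proof -
    obtain s where s: "finite s" "H s \<inter> remainder = {}" "Z = H s" using Z by (auto simp: \<Z>_def)
    have "closedin K Z" using H_closed s(1,3) by simp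
    then have "compactin K Z" "Z \<subseteq> topspace K"
      using closedin_compact_space[OF compact_K] closedin_subset by auto
    then show ?thesis using s(2,3) by (auto simp: compactin_group)
  qed
  moreover have "x \<in> \<Union>\<Z>" if x: "x \<in> \<Omega>" "x \<in> topspace T" for x
  proof (rule ccontr)
    assume "x \<notin> \<Union>\<Z>"
    have xQ: "x \<in> Q"
      using closure_of_subset[OF openin_subset[OF \<Omega>(1)]] x(1) by (auto simp: Q_def)
    obtain C where C: "C \<in> \<C>" "x \<in> C" using \<C>(2) x(2) by auto
    have "closedin T C" "countably_compactin T C" using \<C>(1) C(1) by auto
    then have C_closed: "closedin K C" by (rule countably_compact_imp_closedin_compactification)
    have CT: "C \<subseteq> topspace T" using \<open>closedin T C\<close> by (rule closedin_subset)
    define S where "S = {F\<in>\<F>. C \<subseteq> F}"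
    have SQ: "S \<subseteq> \<F>Q" using C(2) xQ by (auto simp: S_def \<F>Q_def)
    have ST: "F \<subseteq> topspace T" if F: "F \<in> S" for F
    proof -
      obtain n where "F \<in> \<G> n" using F \<G>(2) by (auto simp: S_def)
      then show ?thesis using \<G>(1) unfolding locally_finite_in_def by auto
    qed
    have x_H: "x \<in> H s" if "s \<subseteq> S" for s
    proof -
      have "x \<in> K closure_of F" if "F \<in> s" for F
      proof -
        have "F \<in> S" using \<open>s \<subseteq> S\<close> that by blast
        then have "F \<subseteq> topspace K" "x \<in> F" using ST[of F] group_subset C(2) by (auto simp: S_def)
        then show ?thesis using closure_of_subset[of F K] by blast
      qed
      then show ?thesis using xQ by (simp add: H_def)
    qed
    have meets: "H s \<inter> remainder \<noteq> {}" if s: "finite s" "s \<subseteq> S" for s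
    proof
      assume "H s \<inter> remainder = {}"
      then have "H s \<in> \<Z>" unfolding \<Z>_def using s SQ by (intro imageI) auto
      then show False using \<open>x \<notin> \<Union>\<Z>\<close> x_H[OF s(2)] by auto
    qed
    define \<U> where "\<U> = insert (K closure_of D) (insert Q ((\<lambda>F. K closure_of F) ` S))"
    have "\<Inter>\<E> \<noteq> {}" if \<E>: "finite \<E>" "\<E> \<subseteq> \<U>" for \<E>
    proof -
      have "finite (\<E> - {K closure_of D, Q})" "\<E> - {K closure_of D, Q} \<subseteq> (\<lambda>F. K closure_of F) ` S"
        using \<E> by (auto simp: \<U>_def)
      then obtain s where s: "s \<subseteq> S" "finite s" "\<E> - {K closure_of D, Q} = (\<lambda>F. K closure_of F) ` s"
        by (meson finite_subset_image)
      have "H s \<inter> remainder \<noteq> {}" using meets s(1,2) by simp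
      then have ys: "y s \<in> H s" "y s \<in> D" "y s \<in> remainder"
        using y[of s] s(1,2) SQ by (auto simp: D_def)
      then have "y s \<in> K closure_of D"
        using closure_of_subset[of D K] \<open>D \<subseteq> remainder\<close> by auto
      moreover have "y s \<in> Q" "\<And>F. F \<in> s \<Longrightarrow> y s \<in> K closure_of F" using ys(1) by (simp_all add: H_def)
      ultimately have "y s \<in> E" if "E \<in> \<E>" for E
        using s(3) that by blast
      then show ?thesis by auto
    qed
    moreover have "\<forall>E\<in>\<U>. closedin K E" using Q_closed by (auto simp: \<U>_def)
    ultimately have "\<Inter>\<U> \<noteq> {}"
      using compact_K unfolding compact_space_fip by simp
    then obtain z where z: "z \<in> \<Inter>\<U>" by auto
    have zL: "z \<in> K closure_of D" and zF: "\<And>F. F \<in> S \<Longrightarrow> z \<in> K closure_of F"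
      using z by (auto simp: \<U>_def)
    have "z \<in> remainder" using zL LY by blast
    then have "z \<in> topspace K - C" using CT by blast
    moreover have "openin K (topspace K - C)" using C_closed by auto
    ultimately obtain N where N: "openin K N" "z \<in> N" "K closure_of N \<subseteq> topspace K - C"
      using regular_space_shrink[OF regular_K] by metis
    \<comment> \<open>A member of the network between \<open>C\<close> and \<open>U\<close> would keep away from \<open>z\<close>.\<close>
    define U where "U = (topspace K - K closure_of N) \<inter> topspace T"
    have "openin T U"
      unfolding openin_group U_def by (intro exI[of _ "topspace K - K closure_of N"]) auto
    moreover have "C \<subseteq> U" using N(3) CT group_subset by (auto simp: U_def)
    ultimately obtain F where F: "F \<in> \<F>" "C \<subseteq> F" "F \<subseteq> U" using network C(1) by metis
    have "N \<subseteq> K closure_of N" using closure_of_subset[OF openin_subset[OF N(1)]] .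
    then have "F \<inter> N = {}" using F(3) by (auto simp: U_def)
    then have "z \<notin> K closure_of F" using N(1,2) unfolding in_closure_of by blast
    then show False using zF[of F] F(1,2) by (simp add: S_def)
  qed
  ultimately show ?thesis
    using \<Omega>(1,2) by (intro exI[of _ \<Omega>] exI[of _ \<Z>]) auto
qed

text \<open>
  Traces on the dense group are nonempty, each meets one of countably many compact sets, and for each of these
  the chain condition applies.
\<close>
lemma countable_disjoint_open_if_sigma_compact_trace:
  assumes \<Z>: "countable \<Z>" "\<And>Z. Z \<in> \<Z> \<Longrightarrow> compactin T Z" and cover: "\<Omega> \<inter> topspace T \<subseteq> \<Union>\<Z>"
    and \<V>: "\<And>V. V \<in> \<V> \<Longrightarrow> openin K V" "\<And>V. V \<in> \<V> \<Longrightarrow> V \<noteq> {}" "\<And>V. V \<in> \<V> \<Longrightarrow> V \<subseteq> \<Omega>"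
    and disj: "pairwise disjnt \<V>"
  shows "countable \<V>"
proof -
  have nonempty: "V \<inter> topspace T \<noteq> {}" if "V \<in> \<V>" for V
    using open_meets_group \<V>(1,2) that by simp
  have inj: "inj_on (\<lambda>V. V \<inter> topspace T) \<V>"
  proof (rule inj_onI, rule ccontr)
    fix V W assume VW: "V \<in> \<V>" "W \<in> \<V>" "V \<inter> topspace T = W \<inter> topspace T" "V \<noteq> W"
    then have "V \<inter> W = {}" using disj by (auto simp: pairwise_def disjnt_def)
    then show False using VW(3) nonempty[OF VW(1)] by auto
  qed
  have part: "countable {V\<in>\<V>. V \<inter> topspace T \<inter> Z \<noteq> {}}" if Z: "Z \<in> \<Z>" for Z
  proof (rule countable_image_inj_on)
    show "inj_on (\<lambda>V. V \<inter> topspace T) {V\<in>\<V>. V \<inter> topspace T \<inter> Z \<noteq> {}}"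
      using inj by (rule inj_on_subset) auto
    show "countable ((\<lambda>V. V \<inter> topspace T) ` {V\<in>\<V>. V \<inter> topspace T \<inter> Z \<noteq> {}})"
    proof (rule countable_disjoint_open_meeting_compact[OF regular_group \<Z>(2)[OF Z]])
      show "openin T U" if "U \<in> (\<lambda>V. V \<inter> topspace T) ` {V\<in>\<V>. V \<inter> topspace T \<inter> Z \<noteq> {}}" for U
        using that \<V>(1) unfolding openin_group by auto
      show "U \<inter> Z \<noteq> {}" if "U \<in> (\<lambda>V. V \<inter> topspace T) ` {V\<in>\<V>. V \<inter> topspace T \<inter> Z \<noteq> {}}" for U
        using that by auto
      show "pairwise disjnt ((\<lambda>V. V \<inter> topspace T) ` {V\<in>\<V>. V \<inter> topspace T \<inter> Z \<noteq> {}})"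
        using disj by (fastforce simp: pairwise_def disjnt_def)
    qed
  qed
  have "V \<in> (\<Union>Z\<in>\<Z>. {V\<in>\<V>. V \<inter> topspace T \<inter> Z \<noteq> {}})" if V: "V \<in> \<V>" for V
  proof -
    obtain v where v: "v \<in> V" "v \<in> topspace T" using nonempty[OF V] by auto
    then have "v \<in> \<Union>\<Z>" using cover \<V>(3)[OF V] by blast
    then obtain Z where "Z \<in> \<Z>" "v \<in> Z" by (rule UnionE)
    then show ?thesis using v V by auto
  qed
  then have "\<V> \<subseteq> (\<Union>Z\<in>\<Z>. {V\<in>\<V>. V \<inter> topspace T \<inter> Z \<noteq> {}})" by (rule subsetI)
  then show ?thesis using countable_UN[OF \<Z>(1) part] by (rule countable_subset)
qed

text \<open>
  The families \<open>\<gamma> n\<close> are disjoint and hence countable, each has dense union in \<open>\<Omega>\<close>, and \<open>\<gamma> (Suc n)\<close> refines \<open>\<gamma> n\<close> with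
  closures and has traces in \<open>\<B> n\<close>. A Baire category argument finds, inside any open \<open>U\<close> around \<open>\<one>\<close>,
  a point \<open>z\<close> in some \<open>V n \<in> \<gamma> n\<close> for all \<open>n\<close>. The traces of the \<open>V n\<close> on the remainder have a common point \<open>t\<close>, because
  countable subsets of the remainder have limit points there. The property of the bases \<open>\<B> n\<close>
  makes the \<open>V n\<close> a base at \<open>t\<close>, so that \<open>z = t\<close> and \<open>V n \<subseteq> U\<close> for some \<open>n\<close>. Points of the remainder chosen in
  the members of all the \<open>\<gamma> n\<close> therefore accumulate at \<open>\<one>\<close>.
\<close>
lemma not_sigma_compact_trace:
  assumes \<Omega>: "openin K \<Omega>" "\<one> \<in> \<Omega>"
    and \<Z>: "countable \<Z>" "\<And>Z. Z \<in> \<Z> \<Longrightarrow> compactin T Z" and cover: "\<Omega> \<inter> topspace T \<subseteq> \<Union>\<Z>"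
  shows False
proof -
  obtain \<B> :: "nat \<Rightarrow> 'a set set"
    where base: "\<forall>n. base_of_topology (subtopology K remainder) (\<B> n)"
    and BCO: "\<forall>x b. (\<forall>n. x \<in> b n \<and> b n \<in> \<B> n) \<and> decseq b \<longrightarrow>
      base_at (subtopology K remainder) x (range b)"
    using BCO_remainder unfolding has_BCO_def by (elim exE conjE)
  define cand where "cand n A = {V. openin K V \<and> V \<noteq> {} \<and> V \<inter> remainder \<in> \<B> n \<and>
      (\<exists>V'\<in>A. K closure_of V \<subseteq> V')}" for n A
  define maxdis where "maxdis \<V> \<W> \<longleftrightarrow> \<W> \<subseteq> \<V> \<and> pairwise disjnt \<W> \<and>
      (\<forall>V\<in>\<V>. V \<noteq> {} \<longrightarrow> (\<exists>W\<in>\<W>. W \<inter> V \<noteq> {}))" for \<V> \<W> :: "'a set set"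
  have "\<exists>\<W>. maxdis \<V> \<W>" for \<V> :: "'a set set"
    unfolding maxdis_def by (rule maximal_disjoint_subfamily[of \<V>]) metis
  then have "\<forall>\<V>. \<exists>\<W>. maxdis \<V> \<W>" by (rule allI)
  from choice[OF this] obtain mx where mx: "\<forall>\<V>. maxdis \<V> (mx \<V>)" by (rule exE)
  define \<gamma> where "\<gamma> = rec_nat {\<Omega>} (\<lambda>n A. mx (cand n A))"
  have \<gamma>0: "\<gamma> 0 = {\<Omega>}" and \<gamma>S: "\<gamma> (Suc n) = mx (cand n (\<gamma> n))" for n
    by (simp_all add: \<gamma>_def)
  have \<gamma>_cand: "\<gamma> (Suc n) \<subseteq> cand n (\<gamma> n)" and \<gamma>_disj_Suc: "pairwise disjnt (\<gamma> (Suc n))"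
    and \<gamma>_max: "\<And>V. V \<in> cand n (\<gamma> n) \<Longrightarrow> V \<noteq> {} \<Longrightarrow> \<exists>W\<in>\<gamma> (Suc n). W \<inter> V \<noteq> {}" for n
    using mx[rule_format, of "cand n (\<gamma> n)"] unfolding \<gamma>S maxdis_def by simp_all
  have \<gamma>_disj: "pairwise disjnt (\<gamma> n)" for n
    by (cases n) (simp_all add: \<gamma>0 \<gamma>_disj_Suc)
  have \<gamma>_mem: "openin K V \<and> V \<noteq> {} \<and> V \<subseteq> \<Omega>" if "V \<in> \<gamma> n" for V n
    using that
  proof (induction n arbitrary: V)
    case 0
    then show ?case using \<Omega> by (auto simp: \<gamma>0)
  next
    case (Suc n)
    then have V: "V \<in> cand n (\<gamma> n)" using \<gamma>_cand by blast
    then obtain V' where V': "V' \<in> \<gamma> n" "K closure_of V \<subseteq> V'" by (auto simp: cand_def)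
    have "openin K V" "V \<noteq> {}" using V by (auto simp: cand_def)
    moreover from this have "V \<subseteq> K closure_of V" by (intro closure_of_subset openin_subset)
    ultimately show ?case using V'(2) Suc.IH[OF V'(1)] by auto
  qed
  have \<gamma>_countable: "countable (\<gamma> n)" for n
    using \<gamma>_mem[of _ n] by (intro countable_disjoint_open_if_sigma_compact_trace[OF \<Z> cover _ _ _ \<gamma>_disj]) auto
  define d where "d V = (SOME x. x \<in> V \<inter> remainder)" for V
  have d: "d V \<in> V \<inter> remainder" if "V \<in> \<gamma> n" for V n
  proof -
    have "\<exists>x. x \<in> V \<inter> remainder" using open_meets_remainder[of V] \<gamma>_mem[OF that] by auto
    then show ?thesis unfolding d_def by (rule someI_ex)
  qed
  define D where "D = d ` (\<Union>n. \<gamma> n)"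
  have "countable D" using \<gamma>_countable by (simp add: D_def)
  moreover have "D \<subseteq> remainder" using d by (auto simp: D_def)
  ultimately have D_closure: "K closure_of D \<subseteq> remainder" by (rule countable_closure)
  have "\<one> \<in> K closure_of D"
    unfolding in_closure_of
  proof (intro conjI allI impI)
    show "\<one> \<in> topspace K" using one_topspace group_subset by blast
    fix U assume U: "\<one> \<in> U \<and> openin K U"
    have "\<exists>p. \<forall>n. (fst (p n) \<in> \<gamma> n \<and> openin K (snd (p n)) \<and> snd (p n) \<noteq> {} \<and>
          snd (p n) \<subseteq> fst (p n) \<and> snd (p n) \<subseteq> U) \<and>
        (K closure_of (snd (p (Suc n))) \<subseteq> snd (p n) \<and> K closure_of (fst (p (Suc n))) \<subseteq> fst (p n))"
    proof (rule dependent_nat_choice)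
      show "\<exists>p. fst p \<in> \<gamma> 0 \<and> openin K (snd p) \<and> snd p \<noteq> {} \<and> snd p \<subseteq> fst p \<and> snd p \<subseteq> U"
        using U \<Omega> by (intro exI[of _ "(\<Omega>, \<Omega> \<inter> U)"]) (auto simp: \<gamma>0)
    next
      fix p n assume p: "fst p \<in> \<gamma> n \<and> openin K (snd p) \<and> snd p \<noteq> {} \<and> snd p \<subseteq> fst p \<and> snd p \<subseteq> U"
      then obtain y where y: "y \<in> snd p" "y \<in> remainder" using open_meets_remainder[of "snd p"] by auto
      have p_open: "openin K (snd p)" using p by simp
      obtain N where N: "openin K N" "y \<in> N" "K closure_of N \<subseteq> snd p"
        using regular_space_shrink[OF regular_K p_open y(1)] .
      have "openin (subtopology K remainder) (N \<inter> remainder)"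
        using N(1) by (auto simp: openin_subtopology)
      moreover have "y \<in> N \<inter> remainder" using N(2) y(2) by simp
      ultimately obtain b where b: "b \<in> \<B> n" "y \<in> b" "b \<subseteq> N \<inter> remainder"
        using base[rule_format, of n] unfolding base_of_topology_def by metis
      have "openin (subtopology K remainder) b"
        using base[rule_format, of n] b(1) unfolding base_of_topology_def by simp
      then obtain M where M: "openin K M" "b = M \<inter> remainder"
        unfolding openin_subtopology by (elim exE conjE)
      define V where "V = M \<inter> N"
      have V: "openin K V" "y \<in> V" using M b(2) N by (auto simp: V_def)
      have "V \<inter> remainder = b" using M(2) b(3) by (auto simp: V_def)
      have VN: "K closure_of V \<subseteq> K closure_of N" unfolding V_def by (intro closure_of_mono) simp
      then have "K closure_of V \<subseteq> fst p" using N(3) p by (meson order_trans)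
      then have "V \<in> cand n (\<gamma> n)"
        unfolding cand_def using V p \<open>V \<inter> remainder = b\<close> b(1) by auto
      then obtain W where W: "W \<in> \<gamma> (Suc n)" "W \<inter> V \<noteq> {}" using \<gamma>_max V(2) by blast
      then have "W \<in> cand n (\<gamma> n)" using \<gamma>_cand by blast
      then obtain V' where V': "V' \<in> \<gamma> n" "K closure_of W \<subseteq> V'" by (auto simp: cand_def)
      have W_open: "openin K W" using \<gamma>_mem[OF W(1)] by simp
      then have "W \<subseteq> K closure_of W" by (intro closure_of_subset openin_subset)
      moreover have "V \<subseteq> K closure_of V" using V(1) by (intro closure_of_subset openin_subset)
      ultimately have "W \<inter> V \<subseteq> V' \<inter> fst p"
        using V'(2) \<open>K closure_of V \<subseteq> fst p\<close> by (intro Int_mono) (rule order_trans, assumption+)+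
      then have "V' \<inter> fst p \<noteq> {}" using W(2) by auto
      \<comment> \<open>Disjointness makes the chosen members of the families decreasing.\<close>
      then have "V' = fst p"
        using \<gamma>_disj[of n] V'(1) p by (auto simp: pairwise_def disjnt_def)
      moreover have "K closure_of (W \<inter> V) \<subseteq> snd p"
        using closure_of_mono[of "W \<inter> V" V K] VN N(3) by auto
      moreover have "W \<inter> V \<subseteq> K closure_of (W \<inter> V)"
        by (intro closure_of_subset le_infI1 openin_subset[OF W_open])
      moreover from calculation have "W \<inter> V \<subseteq> U"
        using p by (meson order_trans)
      ultimately show "\<exists>q. (fst q \<in> \<gamma> (Suc n) \<and> openin K (snd q) \<and> snd q \<noteq> {} \<and>
          snd q \<subseteq> fst q \<and> snd q \<subseteq> U) \<and>
          K closure_of snd q \<subseteq> snd p \<and> K closure_of fst q \<subseteq> fst p"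
        using W W_open V(1) V'(2) by (intro exI[of _ "(W, W \<inter> V)"]) auto
    qed
    then obtain p where p: "\<forall>n. (fst (p n) \<in> \<gamma> n \<and> openin K (snd (p n)) \<and> snd (p n) \<noteq> {} \<and>
          snd (p n) \<subseteq> fst (p n) \<and> snd (p n) \<subseteq> U) \<and>
        (K closure_of (snd (p (Suc n))) \<subseteq> snd (p n) \<and> K closure_of (fst (p (Suc n))) \<subseteq> fst (p n))"
      by (rule exE)
    define V where "V n = fst (p n)" for n
    define O' where "O' n = snd (p n)" for n
    have V: "V n \<in> \<gamma> n" "K closure_of (V (Suc n)) \<subseteq> V n" for n
      using p by (simp_all add: V_def)
    have O': "openin K (O' n)" "O' n \<noteq> {}" "O' n \<subseteq> V n" "O' n \<subseteq> U" "K closure_of (O' (Suc n)) \<subseteq> O' n" for n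
      using p by (simp_all add: V_def O'_def)
    have V_open: "openin K (V n)" for n using \<gamma>_mem[OF V(1)] by simp
    have V_closure: "V n \<subseteq> K closure_of (V n)" for n
      using V_open by (intro closure_of_subset openin_subset)
    have O'_closure: "O' n \<subseteq> K closure_of (O' n)" for n
      using O'(1) by (intro closure_of_subset openin_subset)
    have V_dec: "V (Suc n) \<subseteq> V n" for n using V(2) V_closure by (rule order_trans[rotated])
    have O'_dec: "O' (Suc n) \<subseteq> O' n" for n using O'(5) O'_closure by (rule order_trans[rotated])

    \<comment> \<open>The Baire point \<open>z\<close>, which at this stage may lie in the group.\<close>
    have "(\<Inter>n. K closure_of (O' n)) \<noteq> {}"
    proof (rule compact_space_imp_nest[OF compact_K])
      show "K closure_of (O' n) \<noteq> {}" for n using O'(2) O'_closure[of n] by auto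
      show "decseq (\<lambda>n. K closure_of (O' n))"
        using O'_dec by (intro decseq_SucI closure_of_mono)
    qed simp
    then obtain z where z: "\<And>n. z \<in> K closure_of (O' n)" by auto
    have zO: "z \<in> O' n" for n using z[of "Suc n"] O'(5)[of n] by blast

    \<comment> \<open>A limit \<open>t\<close> of points of the remainder, which stays in the remainder.\<close>
    define y where "y n = d (V n)" for n
    have y: "y n \<in> V n" "y n \<in> remainder" for n using d[OF V(1)] by (auto simp: y_def)
    have V_antimono: "V m \<subseteq> V n" if "n \<le> m" for m n
      using V_dec that by (rule lift_Suc_antimono_le)
    have "(\<Inter>n. K closure_of (y ` {n..})) \<noteq> {}"
    proof (rule compact_space_imp_nest[OF compact_K])
      show "K closure_of (y ` {n..}) \<noteq> {}" for n
      proof -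
        have "y ` {n..} \<subseteq> K closure_of (y ` {n..})" using y(2) by (intro closure_of_subset) auto
        then show ?thesis by auto
      qed
      show "decseq (\<lambda>n. K closure_of (y ` {n..}))"
        by (intro decseq_SucI closure_of_mono image_mono) auto
    qed simp
    then obtain t where t: "\<And>n. t \<in> K closure_of (y ` {n..})" by auto
    have "K closure_of (y ` {0..}) \<subseteq> remainder" using y(2) by (intro countable_closure) auto
    then have t_rem: "t \<in> remainder" using t[of 0] by (rule subsetD)
    have tV: "t \<in> V n" for n
    proof -
      have "y ` {Suc n..} \<subseteq> V (Suc n)" using y(1) V_antimono by fastforce
      then have "K closure_of (y ` {Suc n..}) \<subseteq> K closure_of (V (Suc n))" by (rule closure_of_mono)
      then show ?thesis using t[of "Suc n"] V(2)[of n] by blast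
    qed
    define b where "b n = V (Suc n) \<inter> remainder" for n
    have "V (Suc n) \<in> cand n (\<gamma> n)" for n using V(1) \<gamma>_cand by blast
    then have "b n \<in> \<B> n" for n by (simp add: b_def cand_def)
    then have "\<forall>n. t \<in> b n \<and> b n \<in> \<B> n" using tV t_rem by (simp add: b_def)
    moreover have "decseq b" using V_dec by (intro decseq_SucI) (auto simp: b_def)
    ultimately have "base_at (subtopology K remainder) t (range b)"
      using BCO by (metis (no_types, lifting))
    then have V_base: "base_at K t (range (\<lambda>n. V (Suc n)))"
      by (rule base_at_dense_extension[OF regular_K remainder_dense]) (simp_all add: V_open b_def)
    have "z = t"
    proof (rule ccontr)
      assume "z \<noteq> t"
      moreover have "z \<in> topspace K" "t \<in> topspace K"
        using zO[of 0] openin_subset[OF O'(1)[of 0]] t_rem by auto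
      ultimately obtain A B where AB: "openin K A" "openin K B" "z \<in> A" "t \<in> B" "disjnt A B"
        using Hausdorff_K unfolding Hausdorff_space_def by metis
      then have "\<exists>W\<in>range (\<lambda>n. V (Suc n)). W \<subseteq> B" using V_base unfolding base_at_def by simp
      then obtain n where "V (Suc n) \<subseteq> B" by auto
      then show False using zO[of "Suc n"] O'(3)[of "Suc n"] AB(3,5) by (auto simp: disjnt_def)
    qed
    then have "t \<in> U" using zO[of 0] O'(4)[of 0] by blast
    then have "\<exists>W\<in>range (\<lambda>n. V (Suc n)). W \<subseteq> U" using V_base U unfolding base_at_def by simp
    then obtain n where "V (Suc n) \<subseteq> U" by auto
    then have "d (V (Suc n)) \<in> U" using d[OF V(1)[of "Suc n"]] by auto
    moreover have "d (V (Suc n)) \<in> D" using V(1)[of "Suc n"] by (auto simp: D_def)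
    ultimately show "\<exists>y. y \<in> D \<and> y \<in> U" by blast
  qed
  then show False using D_closure one_topspace by blast
qed

lemma not_Sigma_space: "\<not> Sigma_space T"
proof
  assume "Sigma_space T"
  from Sigma_space_imp_locally_sigma_compact[OF this]
  obtain \<Omega> \<Z> where "openin K \<Omega>" "\<one> \<in> \<Omega>" "countable \<Z>" "\<forall>Z\<in>\<Z>. compactin T Z"
    "\<Omega> \<inter> topspace T \<subseteq> \<Union>\<Z>"
    by (elim exE conjE)
  then show False using not_sigma_compact_trace[of \<Omega> \<Z>] by simp
qed

end

section \<open>Metrizability\<close>

theorem theorem4p3:
  fixes G :: "('a, 'b) monoid_scheme" and T bG :: "'a topology"
  assumes "topological_group G T"
    and "\<not> locally_compact_space T"
    and "Hausdorff_compactification T bG"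
    and "has_BCO (subtopology bG (topspace bG - topspace T))"
    and "Sigma_space T"
  shows "separable_space T \<and> metrizable_space T \<and>
    separable_space bG \<and> metrizable_space bG"
proof -
  interpret topological_group G T by (rule assms(1))
  interpret group_with_BCO_remainder G T bG
    using assms(2-4) by unfold_locales
  have "\<not> (\<forall>D. countable D \<and> D \<subseteq> remainder \<longrightarrow> bG closure_of D \<subseteq> remainder)"
  proof
    assume "\<forall>D. countable D \<and> D \<subseteq> remainder \<longrightarrow> bG closure_of D \<subseteq> remainder"
    then interpret group_with_omega_bounded_BCO_remainder G T bG
      by unfold_locales simp
    show False using not_Sigma_space assms(5) by simp
  qed
  then obtain D where D: "countable D" "D \<subseteq> remainder" "\<not> bG closure_of D \<subseteq> remainder"
    by auto
  then obtain p where "p \<in> bG closure_of D" "p \<in> topspace T"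
    using closure_of_subset_topspace[of bG D] by blast
  from countable_base_at_one_if_group_meets_separable_closure[OF D(1,2) this]
  obtain \<B> where "countable \<B>" "base_at T \<one>\<^bsub>G\<^esub> \<B>" by (elim exE conjE)
  then have sc: "second_countable bG" by (rule second_countable_if_countable_base_at_one)
  then have "metrizable_space bG"
    using compact_Hausdorff_second_countable_imp_metrizable compact_K Hausdorff_K by blast
  moreover have "metrizable_space T"
    using metrizable_space_subtopology[OF calculation, of "topspace T"] by (simp add: subtopology_group)
  moreover have "second_countable T"
    using second_countable_subtopology[OF sc, of "topspace T"] by (simp add: subtopology_group)
  ultimately show ?thesis using sc by (simp add: second_countable_imp_separable_space)
qed

end
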